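(* Let $\gamma>0$. The class $\mathcal H^{\rm D}\mathcal I_\gamma^{\rm s\omega}$ is a subalgebra of $\mathcal H^{\rm D}\mathcal I_\gamma^{\omega}$ (with product $*_\gamma$). Its subclass $\mathcal H^{\rm S}\mathcal I_\gamma^{\rm s\omega}$ is a left ideal of $\mathcal H^{\rm S}\mathcal I_\gamma^{\omega}$, of $\mathcal H^{\rm D}\mathcal I_\gamma^{\omega}$ and of $\mathcal H^{\rm D}\mathcal I_\gamma^{\rm s\omega}$.
   Context: Fix $0<q<1$. $[e]_q=\frac{1-q^e}{1-q}$, $[e]_q!=[1]_q\cdots[e]_q$. The $q$-derivative is $(\partial f)(x)=\frac{f(x)-f(qx)}{(1-q)x}$ for $x\ne0$; for functions holomorphic near $0$ its value at $0$ is given by analytic continuation. For $\gamma>0$ let $L(\gamma)=\{\pm q^k\gamma\mid k\in\mathbf Z\}$ and $\int_\gamma f=(1-q)\sum_{k\in\mathbf Z}\sum_{\epsilon=\pm1}q^k\gamma f(\epsilon q^k\gamma)$ when the sum converges absolutely. $\mathcal I_\gamma^\infty$ is the space of functions $f$ on $L(\gamma)$ such that for all $e\in\mathbf Z_{\ge0}$ this sum converges absolutely for $x\mapsto f(x)x^e$. For $f\in\mathcal I_\gamma^\infty$: $\mu_{e,\gamma}(f)=q^{(e^2+e)/2}\int_\gamma f(x)x^e$ and $\nu_{e,\gamma}(f)=q^{(e^2+e)/2}\int_\gamma|f(x)x^e|$. $q$-convolution: $(f*_\gamma g)(x)=\sum_{e=0}^\infty\frac{(-1)^e\mu_{e,\gamma}(f)}{[e]_q!}(\partial^e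 g)(x)$, at points $x$ where all $(\partial^eg)(x)$ are defined and the series converges absolutely. $\mathcal I_\gamma^{\omega}$ (resp. $\mathcal I_\gamma^{\rm s\omega}$) is the set of $f\in\mathcal I_\gamma^\infty$ such that for some $\alpha,b>0$, $|\mu_{e,\gamma}(f)|$ (resp. $\nu_{e,\gamma}(f)$) is $O(q^{\alpha e^2/2}b^e)$ as $e\to\infty$. For $\mathcal I$ one of these spaces, $\mathcal H^{\rm D}\mathcal I$ is the set of $f\in\mathcal I$ which coincide, at the points of $L(\gamma)$ in some disk centered at $0$, with a function holomorphic on that disk, and $\mathcal H^{\rm S}\mathcal I$ is the set of $f\in\mathcal I$ which are restrictions to $L(\gamma)$ of a function holomorphic on some strip $\{z\in\mathbf C\mid|{\rm Im}(z)|<a\}$, $a>0$. $\mathcal H^{\rm D}\mathcal I_\gamma^{\omega}$ and $\mathcal H^{\rm S}\mathcal I_\gamma^{\omega}$ are associative (not necessarily unital) algebras under $*_\gamma$. *)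

theory Defs
  imports
    "HOL-Complex_Analysis.Complex_Analysis"
    "HOL-Library.Landau_Symbols"
    "HOL-Library.Function_Algebras"
begin

text \<open>A function on the lattice \<open>L(\<gamma>)\<close> is represented by the function of type
  \<^typ>\<open>real \<Rightarrow> complex\<close> that extends it by zero, so that equality and the
  pointwise vector space operations are those of functions on \<open>L(\<gamma>)\<close>.\<close>

global_interpretation cfun: vector_space "\<lambda>(c::complex) (f::real \<Rightarrow> complex) x. c * f x"
  by unfold_locales (auto simp: fun_eq_iff algebra_simps)

definition qnum :: "real \<Rightarrow> nat \<Rightarrow> real" where
  "qnum q e = (1 - q ^ e) / (1 - q)"

definition qfact :: "real \<Rightarrow> nat \<Rightarrow> real" where
  "qfact q e = (\<Prod>i=1..e. qnum q i)"

definition qlattice :: "real \<Rightarrow> real \<Rightarrow> real set" where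
  "qlattice q \<gamma> = {\<epsilon> * q powi k * \<gamma> | \<epsilon> k. \<epsilon> \<in> {1, -1}}"

text \<open>The \<open>q\<close>-derivative is only ever evaluated at points of \<open>L(\<gamma>)\<close>, which is stable under
  multiplication by \<open>q\<close> and does not contain \<open>0\<close>; the value that division by zero
  gives at \<open>x = 0\<close> is not the one obtained by analytic continuation and plays no role.\<close>

definition qderiv :: "real \<Rightarrow> (real \<Rightarrow> complex) \<Rightarrow> real \<Rightarrow> complex" where
  "qderiv q f x = (f x - f (q * x)) / complex_of_real ((1 - q) * x)"

definition qintegrand :: "real \<Rightarrow> real \<Rightarrow> (real \<Rightarrow> 'a) \<Rightarrow> int \<times> real \<Rightarrow> 'a::real_normed_vector" where
  "qintegrand q \<gamma> f = (\<lambda>(k, \<epsilon>). (q powi k * \<gamma>) *\<^sub>R f (\<epsilon> * q powi k * \<gamma>))"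

definition qintegrable :: "real \<Rightarrow> real \<Rightarrow> (real \<Rightarrow> 'a::real_normed_vector) \<Rightarrow> bool" where
  "qintegrable q \<gamma> f \<longleftrightarrow> qintegrand q \<gamma> f abs_summable_on (UNIV \<times> {1, -1})"

definition qint :: "real \<Rightarrow> real \<Rightarrow> (real \<Rightarrow> 'a) \<Rightarrow> 'a::real_normed_vector" where
  "qint q \<gamma> f = (1 - q) *\<^sub>R (\<Sum>\<^sub>\<infinity>p \<in> UNIV \<times> {1, -1}. qintegrand q \<gamma> f p)"

definition qmoment :: "real \<Rightarrow> real \<Rightarrow> nat \<Rightarrow> (real \<Rightarrow> complex) \<Rightarrow> complex" where
  "qmoment q \<gamma> e f =
     of_real (q powr ((real e ^ 2 + real e) / 2)) * qint q \<gamma> (\<lambda>x. f x * of_real x ^ e)"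

definition qabs_moment :: "real \<Rightarrow> real \<Rightarrow> nat \<Rightarrow> (real \<Rightarrow> complex) \<Rightarrow> real" where
  "qabs_moment q \<gamma> e f =
     q powr ((real e ^ 2 + real e) / 2) * qint q \<gamma> (\<lambda>x. cmod (f x * of_real x ^ e))"

definition qconv_term ::
    "real \<Rightarrow> real \<Rightarrow> (real \<Rightarrow> complex) \<Rightarrow> (real \<Rightarrow> complex) \<Rightarrow> real \<Rightarrow> nat \<Rightarrow> complex" where
  "qconv_term q \<gamma> f g x e =
     (-1) ^ e * qmoment q \<gamma> e f / of_real (qfact q e) * (qderiv q ^^ e) g x"

text \<open>All the \<open>q\<close>-derivatives of a function on \<open>L(\<gamma>)\<close> are defined on \<open>L(\<gamma>)\<close>, so that the
  convolution of two such functions is defined on all of \<open>L(\<gamma>)\<close> as soon as the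
  series converges absolutely at every point.\<close>

definition qconv_defined ::
    "real \<Rightarrow> real \<Rightarrow> (real \<Rightarrow> complex) \<Rightarrow> (real \<Rightarrow> complex) \<Rightarrow> bool" where
  "qconv_defined q \<gamma> f g \<longleftrightarrow>
     (\<forall>x \<in> qlattice q \<gamma>. summable (\<lambda>e. cmod (qconv_term q \<gamma> f g x e)))"

definition qconv ::
    "real \<Rightarrow> real \<Rightarrow> (real \<Rightarrow> complex) \<Rightarrow> (real \<Rightarrow> complex) \<Rightarrow> real \<Rightarrow> complex" where
  "qconv q \<gamma> f g x = (if x \<in> qlattice q \<gamma> then \<Sum>e. qconv_term q \<gamma> f g x e else 0)"

definition I_infty :: "real \<Rightarrow> real \<Rightarrow> (real \<Rightarrow> complex) set" where
  "I_infty q \<gamma> =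
     {f. (\<forall>x. x \<notin> qlattice q \<gamma> \<longrightarrow> f x = 0) \<and>
         (\<forall>e::nat. qintegrable q \<gamma> (\<lambda>x. f x * of_real x ^ e))}"

definition I_omega :: "real \<Rightarrow> real \<Rightarrow> (real \<Rightarrow> complex) set" where
  "I_omega q \<gamma> =
     {f \<in> I_infty q \<gamma>. \<exists>\<alpha>>0. \<exists>b>0.
        (\<lambda>e. cmod (qmoment q \<gamma> e f)) \<in> O(\<lambda>e. q powr (\<alpha> * real e ^ 2 / 2) * b ^ e)}"

definition I_s_omega :: "real \<Rightarrow> real \<Rightarrow> (real \<Rightarrow> complex) set" where
  "I_s_omega q \<gamma> =
     {f \<in> I_infty q \<gamma>. \<exists>\<alpha>>0. \<exists>b>0.
        (\<lambda>e. qabs_moment q \<gamma> e f) \<in> O(\<lambda>e. q powr (\<alpha> * real e ^ 2 / 2) * b ^ e)}"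

definition HD :: "real \<Rightarrow> real \<Rightarrow> (real \<Rightarrow> complex) set \<Rightarrow> (real \<Rightarrow> complex) set" where
  "HD q \<gamma> I =
     {f \<in> I. \<exists>r>0. \<exists>F. F holomorphic_on ball 0 r \<and>
        (\<forall>x \<in> qlattice q \<gamma>. \<bar>x\<bar> < r \<longrightarrow> f x = F (complex_of_real x))}"

definition HS :: "real \<Rightarrow> real \<Rightarrow> (real \<Rightarrow> complex) set \<Rightarrow> (real \<Rightarrow> complex) set" where
  "HS q \<gamma> I =
     {f \<in> I. \<exists>a>0. \<exists>F. F holomorphic_on {z. \<bar>Im z\<bar> < a} \<and>
        (\<forall>x \<in> qlattice q \<gamma>. f x = F (complex_of_real x))}"

text \<open>Subalgebras and left ideals are taken over \<open>\<complex>\<close> and need not contain a unit.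
  Products are required to exist, i.e. the convolution series to converge absolutely,
  because \<open>suminf\<close> is total.\<close>

definition qsubalgebra ::
    "real \<Rightarrow> real \<Rightarrow> (real \<Rightarrow> complex) set \<Rightarrow> (real \<Rightarrow> complex) set \<Rightarrow> bool" where
  "qsubalgebra q \<gamma> B A \<longleftrightarrow>
     B \<subseteq> A \<and> cfun.subspace B \<and>
     (\<forall>f \<in> B. \<forall>g \<in> B. qconv_defined q \<gamma> f g \<and> qconv q \<gamma> f g \<in> B)"

definition qleft_ideal ::
    "real \<Rightarrow> real \<Rightarrow> (real \<Rightarrow> complex) set \<Rightarrow> (real \<Rightarrow> complex) set \<Rightarrow> bool" where
  "qleft_ideal q \<gamma> J A \<longleftrightarrow>
     J \<subseteq> A \<and> cfun.subspace J \<and>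
     (\<forall>f \<in> A. \<forall>g \<in> J. qconv_defined q \<gamma> f g \<and> qconv q \<gamma> f g \<in> J)"

end

theory Submission imports Defs begin

text \<open>
  Write \<open>\<nu>\<^sub>e\<close> for the absolute moments. Shifting the lattice by \<open>q\<close> gives
  \<open>\<nu>\<^sub>e(\<partial>h) \<le> 2/(1-q) \<nu>\<^sub>e\<^sub>-\<^sub>1(h)\<close> for \<open>e \<ge> 1\<close>, while the maximum principle near \<open>0\<close> bounds
  \<open>\<partial>\<^sup>n g\<close> by \<open>M w\<^sup>n\<close> uniformly on the lattice, which controls \<open>\<nu>\<^sub>0(\<partial>\<^sup>n g)\<close>. So
  \<open>\<nu>\<^sub>e(\<partial>\<^sup>n g)\<close> is at most \<open>K c\<^sup>n\<close> times the Gaussian bound for \<open>\<nu>\<close> of \<open>g\<close> at \<open>max(e-n, 0)\<close>.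
  Summing against the Gaussian decay of the moments of \<open>f\<close> and using
  \<open>n\<^sup>2 + max(e-n, 0)\<^sup>2 \<ge> e\<^sup>2/2\<close> shows that \<open>f * g\<close> is in the strict class as soon as \<open>f\<close> has
  Gaussian moments and \<open>g\<close> is in the strict class and holomorphic near \<open>0\<close>. The same geometric
  bound for \<open>\<partial>\<^sup>n\<close>, on compact convex sets containing a disk around \<open>0\<close>, makes the convolution
  series converge locally uniformly on any convex open set on which \<open>g\<close> is holomorphic, be it a
  disk or a strip.
\<close>

subsection \<open>Iterated \<open>q\<close>-derivatives of holomorphic functions\<close>

lemma cmod_le_cball_of_sphere:
  assumes "f holomorphic_on U" "cball 0 r \<subseteq> U" "0 < r"
    and le: "\<And>z. cmod z = r \<Longrightarrow> cmod (f z) \<le> B" and "cmod z \<le> r"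
  shows "cmod (f z) \<le> B"
proof (rule maximum_modulus_frontier[of f "cball 0 r"])
  show "f holomorphic_on interior (cball 0 r)"
    using assms(1,2) by (rule holomorphic_on_subset[OF _ order_trans[OF interior_subset]])
  show "continuous_on (closure (cball 0 r)) f"
    using assms(1,2) by (auto intro: holomorphic_on_imp_continuous_on holomorphic_on_subset)
qed (use assms in auto)

text \<open>The value at \<open>0\<close> is the analytic continuation of the difference quotient.\<close>

definition cqderiv :: "real \<Rightarrow> (complex \<Rightarrow> complex) \<Rightarrow> complex \<Rightarrow> complex" where
  "cqderiv q F z = (if z = 0 then deriv (\<lambda>w. (F w - F (of_real q * w)) / (1 - of_real q)) 0
     else (F z - F (of_real q * z)) / ((1 - of_real q) * z))"

lemma cqderiv_eq_qderiv:
  "x \<noteq> 0 \<Longrightarrow> F (of_real x) = h x \<Longrightarrow> F (of_real (q * x)) = h (q * x) \<Longrightarrow>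
    cqderiv q F (of_real x) = qderiv q h x"
  by (simp add: cqderiv_def qderiv_def)

text \<open>The point \<open>of_real q * z\<close> lies on the segment from 0 to \<open>z\<close>.
  Iterating the q-derivative needs stability under this scaling, and convexity is how disks, strips
  and hulls obtain it.\<close>

lemma convex_qscale:
  fixes K :: "complex set"
  assumes "convex K" "0 \<in> K" "0 < q" "q < 1" "z \<in> K"
  shows "of_real q * z \<in> K"
  using convexD_alt[OF assms(1,2,5), of q] assms(3,4) by (simp add: scaleR_conv_of_real)

text \<open>The numerator vanishes at 0, so the singularity of the quotient there is
  removable.\<close>

lemma holomorphic_cqderiv:
  assumes "F holomorphic_on U" "open U" "0 < q" "q < 1"
    and U: "\<And>z. z \<in> U \<Longrightarrow> of_real q * z \<in> U"
  shows "cqderiv q F holomorphic_on U"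
proof (rule pole_theorem_open_0[where a = 0])
  show "(\<lambda>w. (F w - F (of_real q * w)) / (1 - of_real q)) holomorphic_on U"
    using assms by (auto intro!: holomorphic_intros holomorphic_on_compose_gen[of _ U F U, unfolded o_def])
  show "cqderiv q F 0 = deriv (\<lambda>w. (F w - F (of_real q * w)) / (1 - of_real q)) 0"
    by (simp add: cqderiv_def)
qed (use assms in \<open>auto simp: cqderiv_def\<close>)

text \<open>By the maximum principle the quotient on a small disk is controlled on its boundary, where
  the denominator is bounded below; hence the iterated derivatives grow only geometrically.\<close>

lemma cmod_cqderiv_le:
  assumes F: "F holomorphic_on U" "open U" "0 < q" "q < 1"
    and U: "\<And>z. z \<in> U \<Longrightarrow> of_real q * z \<in> U"
    and K: "K \<subseteq> U" "cball 0 r \<subseteq> K" "0 < r" "\<And>z. z \<in> K \<Longrightarrow> of_real q * z \<in> K"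
    and le: "\<And>z. z \<in> K \<Longrightarrow> cmod (F z) \<le> M" and "z \<in> K"
  shows "cmod (cqderiv q F z) \<le> 2 / ((1 - q) * r) * M"
proof -
  have far: "cmod (cqderiv q F z) \<le> 2 / ((1 - q) * r) * M" if z: "z \<in> K" "r \<le> cmod z" for z
  proof -
    have "cmod (1 - of_real q) = 1 - q"
      using F(3,4) by (metis abs_of_pos diff_gt_0_iff_gt norm_of_real of_real_1 of_real_diff)
    moreover have "z \<noteq> 0"
      using z K(3) by auto
    ultimately have "cmod (cqderiv q F z) = cmod (F z - F (of_real q * z)) / ((1 - q) * cmod z)"
      by (simp add: cqderiv_def norm_divide norm_mult)
    also have "\<dots> \<le> (M + M) / ((1 - q) * r)"
      using z K(3,4) F(3,4) le[of z] le[of "of_real q * z"] order_trans[OF norm_ge_zero le[of z]]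
        norm_triangle_ineq4[of "F z" "F (of_real q * z)"]
      by (intro frac_le mult_mono) auto
    finally show ?thesis
      by simp
  qed
  show ?thesis
  proof (cases "cmod z \<le> r")
    case True
    show ?thesis
    proof (rule cmod_le_cball_of_sphere[OF holomorphic_cqderiv[OF F U]])
      show "cball 0 r \<subseteq> U" using K by blast
      show "cmod (cqderiv q F w) \<le> 2 / ((1 - q) * r) * M" if "cmod w = r" for w
        using that K by (intro far) auto
    qed (use True K in auto)
  next
    case False
    then show ?thesis
      using far \<open>z \<in> K\<close> by auto
  qed
qed

text \<open>Each step costs the same factor because \<open>U\<close> and \<open>K\<close> never
  shrink, unlike with Cauchy estimates. Holomorphy of all iterates comes first, since the one-step
  bound is applied to each of them.\<close>

lemma cqderiv_iterate:
  assumes F: "F holomorphic_on U" "open U" "0 < q" "q < 1"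
    and U: "\<And>z. z \<in> U \<Longrightarrow> of_real q * z \<in> U"
  shows "(cqderiv q ^^ n) F holomorphic_on U"
    and "\<lbrakk>K \<subseteq> U; cball 0 r \<subseteq> K; 0 < r; \<And>z. z \<in> K \<Longrightarrow> of_real q * z \<in> K;
      \<And>z. z \<in> K \<Longrightarrow> cmod (F z) \<le> M; z \<in> K\<rbrakk> \<Longrightarrow>
      cmod ((cqderiv q ^^ n) F z) \<le> (2 / ((1 - q) * r)) ^ n * M"
proof -
  show hol: "(cqderiv q ^^ n) F holomorphic_on U" for n
    by (induction n) (auto intro: holomorphic_cqderiv F U)
  assume K: "K \<subseteq> U" "cball 0 r \<subseteq> K" "0 < r" "\<And>z. z \<in> K \<Longrightarrow> of_real q * z \<in> K"
    and le: "\<And>z. z \<in> K \<Longrightarrow> cmod (F z) \<le> M" and z: "z \<in> K"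
  show "cmod ((cqderiv q ^^ n) F z) \<le> (2 / ((1 - q) * r)) ^ n * M"
    using z
  proof (induction n arbitrary: z)
    case 0
    then show ?case using le by simp
  next
    case (Suc n)
    show ?case
      using cmod_cqderiv_le[OF hol F(2-4) U K Suc.IH Suc.prems] by (simp add: mult_ac)
  qed
qed

text \<open>On a set stable under \<open>q\<close> and avoiding 0, both difference quotients read
  only values inside the set, so the continuation at 0 never enters. Later \<open>S\<close> consists
  of the lattice points in the domain of \<open>F\<close>.\<close>

lemma qderiv_iterate_eq_cqderiv:
  assumes S: "\<And>x. x \<in> S \<Longrightarrow> q * x \<in> S" "0 \<notin> S"
    and h: "\<And>x. x \<in> S \<Longrightarrow> h x = F (of_real x)" and "x \<in> S"
  shows "(qderiv q ^^ n) h x = (cqderiv q ^^ n) F (of_real x)"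
  using \<open>x \<in> S\<close>
proof (induction n arbitrary: x)
  case 0
  then show ?case using h by simp
next
  case (Suc n)
  then show ?case
    using S by (auto intro!: cqderiv_eq_qderiv[symmetric] simp del: of_real_mult)
qed

text \<open>The iterates grow at most geometrically on suitable compact sets, so rapidly decaying
  coefficients give locally uniform convergence. The growth rate depends on the disk around 0, hence
  summability for every \<open>w\<close>.\<close>

lemma holomorphic_cqderiv_series:
  fixes a :: "nat \<Rightarrow> complex"
  assumes F: "F holomorphic_on U" "open U" "convex U" "0 \<in> U" "0 < q" "q < 1"
    and a: "\<And>w. 0 < w \<Longrightarrow> summable (\<lambda>n. cmod (a n) * w ^ n)"
  shows "(\<lambda>z. \<Sum>n. a n * (cqderiv q ^^ n) F z) holomorphic_on U"
proof (rule holomorphic_uniform_sequence[OF F(2)])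
  have U: "of_real q * z \<in> U" if "z \<in> U" for z
    using convex_qscale F that by blast
  note F' = F(1,2,5,6) U
  show "(\<lambda>z. \<Sum>n<N. a n * (cqderiv q ^^ n) F z) holomorphic_on U" for N
    by (intro holomorphic_intros cqderiv_iterate(1)[OF F'])
  fix x assume "x \<in> U"
  then obtain d where d: "0 < d" "cball x d \<subseteq> U"
    using F(2) open_contains_cball by metis
  obtain r where r: "0 < r" "cball 0 r \<subseteq> U"
    using F(2,4) open_contains_cball by metis
  \<comment> \<open>The derivative bound needs a disk around 0, uniform convergence a disk around
    \<open>x\<close>. The hull of both is convex, hence stable under scaling, and compact, so
    \<open>F\<close> is bounded on it.\<close>
  define K where "K = convex hull (cball 0 r \<union> cball x d)"
  have K: "K \<subseteq> U" "cball 0 r \<subseteq> K" "cball x d \<subseteq> K" "convex K" "compact K"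
  proof -
    show "K \<subseteq> U"
      unfolding K_def using r d F(3) by (intro hull_minimal) auto
    show "cball 0 r \<subseteq> K" "cball x d \<subseteq> K"
      using hull_subset[of "cball 0 r \<union> cball x d" convex] by (auto simp: K_def)
    show "convex K" "compact K"
      unfolding K_def by (intro convex_convex_hull compact_convex_hull compact_Un compact_cball)+
  qed
  have "0 \<in> K"
    using r K(2) by auto
  then have Kq: "of_real q * z \<in> K" if "z \<in> K" for z
    using convex_qscale K(4) F(5,6) that by blast
  have "compact (F ` K)"
    using K holomorphic_on_subset[OF F(1) K(1)]
    by (intro compact_continuous_image holomorphic_on_imp_continuous_on)
  then obtain M where M: "\<And>z. z \<in> K \<Longrightarrow> cmod (F z) \<le> M"
    by (meson bounded_iff compact_imp_bounded imageI)
  define w where "w = 2 / ((1 - q) * r)"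
  have "0 < w"
    using r F by (simp add: w_def)
  have "uniform_limit (cball x d) (\<lambda>N z. \<Sum>n<N. a n * (cqderiv q ^^ n) F z)
      (\<lambda>z. \<Sum>n. a n * (cqderiv q ^^ n) F z) sequentially"
  proof (rule Weierstrass_m_test)
    show "summable (\<lambda>n. cmod (a n) * w ^ n * M)"
      using a[OF \<open>0 < w\<close>] by (rule summable_mult2)
    show "norm (a n * (cqderiv q ^^ n) F z) \<le> cmod (a n) * w ^ n * M" if "z \<in> cball x d" for n z
      using cqderiv_iterate(2)[OF F' K(1,2) r(1) Kq M, of z n] that K(3)
      by (auto simp: norm_mult w_def mult.assoc intro!: mult_left_mono)
  qed
  then show "\<exists>d>0. cball x d \<subseteq> U \<and> uniform_limit (cball x d)
      (\<lambda>N z. \<Sum>n<N. a n * (cqderiv q ^^ n) F z) (\<lambda>z. \<Sum>n. a n * (cqderiv q ^^ n) F z) sequentially"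
    using d by blast
qed

subsection \<open>Gaussian bounds\<close>

definition gaussian_bounded :: "real \<Rightarrow> (nat \<Rightarrow> real) \<Rightarrow> bool" where
  "gaussian_bounded q u \<longleftrightarrow> (\<exists>\<alpha>>0. \<exists>b>0. \<exists>C>0. \<forall>e. \<bar>u e\<bar> \<le> C * (q powr (\<alpha> * real e ^ 2 / 2) * b ^ e))"

text \<open>A constant valid for all \<open>e\<close> suits termwise estimates better than an
  eventual bound. Nothing is lost: the comparison function never vanishes, so the quotients, being
  eventually bounded, are bounded.\<close>

lemma gaussian_bounded_iff_bigo:
  assumes "0 < q"
  shows "gaussian_bounded q u \<longleftrightarrow>
    (\<exists>\<alpha>>0. \<exists>b>0. u \<in> O(\<lambda>e. q powr (\<alpha> * real e ^ 2 / 2) * b ^ e))"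
proof -
  have "(\<exists>C>0. \<forall>e. \<bar>u e\<bar> \<le> C * (q powr (\<alpha> * real e ^ 2 / 2) * b ^ e)) \<longleftrightarrow>
      u \<in> O(\<lambda>e. q powr (\<alpha> * real e ^ 2 / 2) * b ^ e)" (is "?l \<longleftrightarrow> ?r") if "b > 0" for \<alpha> b
  proof
    assume ?l
    then obtain C where "\<And>e. \<bar>u e\<bar> \<le> C * (q powr (\<alpha> * real e ^ 2 / 2) * b ^ e)"
      by blast
    then show ?r
      using assms that by (intro bigoI[where c = C] always_eventually) auto
  next
    let ?g = "\<lambda>e::nat. q powr (\<alpha> * real e ^ 2 / 2) * b ^ e"
    have g: "?g e > 0" for e
      using assms that by simp
    assume ?r
    then obtain c where "eventually (\<lambda>e. norm (u e) \<le> c * norm (?g e)) sequentially"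
      by (rule landau_o.bigE)
    then have "eventually (\<lambda>e. norm (u e / ?g e) \<le> c) sequentially"
      by eventually_elim
        (use g in \<open>simp only: norm_divide pos_divide_le_eq zero_less_norm_iff less_imp_neq[symmetric] not_False_eq_True\<close>)
    then have "Bseq (\<lambda>e. u e / ?g e)"
      by (rule BfunI)
    then obtain C where "C > 0" and C: "\<And>e. norm (u e / ?g e) \<le> C"
      by (rule BseqE) blast
    then have "\<bar>u e\<bar> \<le> C * ?g e" for e
    proof -
      have "\<bar>u e\<bar> / \<bar>?g e\<bar> \<le> C"
        using C[of e] unfolding real_norm_def abs_divide .
      then show ?thesis
        using g[of e] by (simp only: abs_of_pos pos_divide_le_eq)
    qed
    with \<open>C > 0\<close> show ?l by blast
  qed
  then show ?thesis
    unfolding gaussian_bounded_def by blast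
qed

text \<open>The term is the \<open>n\<close>-th power of a sequence tending to 0, hence eventually
  at most \<open>(1 / 2) ^ n\<close>; the quadratic exponent beats any \<open>b\<close>.\<close>

lemma summable_gaussian:
  fixes q :: real
  assumes "0 < q" "q < 1" "0 < \<alpha>" "0 < b"
  shows "summable (\<lambda>n. q powr (\<alpha> * real n ^ 2 / 2) * b ^ n)"
proof -
  have "(\<lambda>n. (q powr (\<alpha> / 2)) ^ n) \<longlonglongrightarrow> 0"
    using assms powr_less_mono'[of q 0 "\<alpha> / 2"] by (intro LIMSEQ_realpow_zero) auto
  then have "(\<lambda>n. (q powr (\<alpha> / 2)) ^ n * b) \<longlonglongrightarrow> 0"
    by (rule tendsto_mult_left_zero)
  then have ev: "eventually (\<lambda>n. (q powr (\<alpha> / 2)) ^ n * b < 1 / 2) sequentially"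
    by (rule order_tendstoD) simp
  have eq: "q powr (\<alpha> * real n ^ 2 / 2) * b ^ n = ((q powr (\<alpha> / 2)) ^ n * b) ^ n" for n
    using assms by (simp add: power_mult_distrib powr_power power2_eq_square mult_ac flip: power_mult)
  show ?thesis
  proof (rule summable_comparison_test_ev)
    show "eventually (\<lambda>n. norm (q powr (\<alpha> * real n ^ 2 / 2) * b ^ n) \<le> (1 / 2) ^ n) sequentially"
      using ev by eventually_elim (use assms in \<open>auto simp: eq intro!: power_mono\<close>)
  qed simp
qed

lemma gaussian_bounded_add:
  assumes "0 < q" "q < 1" "gaussian_bounded q u" "gaussian_bounded q v"
  shows "gaussian_bounded q (\<lambda>e. u e + v e)"
proof -
  obtain \<alpha> b C where u: "\<alpha> > 0" "b > 0" "C > 0" "\<And>e. \<bar>u e\<bar> \<le> C * (q powr (\<alpha> * real e ^ 2 / 2) * b ^ e)"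
    using assms(3) unfolding gaussian_bounded_def by blast
  obtain \<beta> d D where v: "\<beta> > 0" "d > 0" "D > 0" "\<And>e. \<bar>v e\<bar> \<le> D * (q powr (\<beta> * real e ^ 2 / 2) * d ^ e)"
    using assms(4) unfolding gaussian_bounded_def by blast
  \<comment> \<open>Since 0 < q < 1, the smaller coefficient in the exponent and the larger base
    give the weaker bound.\<close>
  let ?g = "\<lambda>e. q powr (min \<alpha> \<beta> * real e ^ 2 / 2) * max b d ^ e"
  have "\<bar>u e + v e\<bar> \<le> (C + D) * ?g e" for e
  proof -
    have "q powr (\<alpha> * real e ^ 2 / 2) * b ^ e \<le> ?g e" "q powr (\<beta> * real e ^ 2 / 2) * d ^ e \<le> ?g e"
      using assms(1,2) u v
      by (auto intro!: mult_mono power_mono powr_mono' divide_right_mono mult_right_mono)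
    then have "C * (q powr (\<alpha> * real e ^ 2 / 2) * b ^ e) \<le> C * ?g e"
       "D * (q powr (\<beta> * real e ^ 2 / 2) * d ^ e) \<le> D * ?g e"
      using u v by (auto intro!: mult_left_mono)
    then show ?thesis
      using u(4)[of e] v(4)[of e] abs_triangle_ineq[of "u e" "v e"] unfolding distrib_right by linarith
  qed
  moreover have "min \<alpha> \<beta> > 0" "max b d > 0" "C + D > 0"
    using u v by auto
  ultimately show ?thesis
    unfolding gaussian_bounded_def by blast
qed

lemma gaussian_bounded_mono:
  assumes "gaussian_bounded q v" and le: "\<And>e. \<bar>u e\<bar> \<le> v e"
  shows "gaussian_bounded q u"
proof -
  obtain \<alpha> b C where v: "\<alpha> > 0" "b > 0" "C > 0" "\<And>e. \<bar>v e\<bar> \<le> C * (q powr (\<alpha> * real e ^ 2 / 2) * b ^ e)"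
    using assms(1) unfolding gaussian_bounded_def by blast
  have "\<bar>u e\<bar> \<le> C * (q powr (\<alpha> * real e ^ 2 / 2) * b ^ e)" for e
    using le[of e] v(4)[of e] by linarith
  with v(1-3) show ?thesis
    unfolding gaussian_bounded_def by blast
qed

lemma gaussian_bounded_cmult:
  assumes "gaussian_bounded q u"
  shows "gaussian_bounded q (\<lambda>e. c * u e)"
proof -
  obtain \<alpha> b C where u: "\<alpha> > 0" "b > 0" "C > 0" "\<And>e. \<bar>u e\<bar> \<le> C * (q powr (\<alpha> * real e ^ 2 / 2) * b ^ e)"
    using assms unfolding gaussian_bounded_def by blast
  \<comment> \<open>Adding 1 keeps the constant positive when \<open>c = 0\<close>.\<close>
  have "\<bar>c * u e\<bar> \<le> ((\<bar>c\<bar> + 1) * C) * (q powr (\<alpha> * real e ^ 2 / 2) * b ^ e)" for e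
    using mult_mono[OF _ u(4)[of e], of "\<bar>c\<bar>" "\<bar>c\<bar> + 1"] by (simp add: abs_mult mult.assoc)
  moreover have "(\<bar>c\<bar> + 1) * C > 0"
    using u(3) by (simp add: add_nonneg_pos)
  ultimately show ?thesis
    using u(1,2) unfolding gaussian_bounded_def by blast
qed

lemma qfact_ge_1: "0 < q \<Longrightarrow> q < 1 \<Longrightarrow> 1 \<le> qfact q e"
  unfolding qfact_def qnum_def
proof (rule prod_ge_1)
  fix i assume "0 < q" "q < 1" "i \<in> {1..e}"
  then have "q ^ i \<le> q ^ 1"
    by (intro power_decreasing) auto
  then show "1 \<le> (1 - q ^ i) / (1 - q)"
    using \<open>q < 1\<close> by simp
qed

subsection \<open>Moments on the lattice\<close>

locale q_lattice =
  fixes q \<gamma> :: real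
  assumes q_pos: "0 < q" and q_less_1: "q < 1" and \<gamma>_pos: "0 < \<gamma>"
begin

abbreviation L :: "real set" where "L \<equiv> qlattice q \<gamma>"

section \<open>The lattice as an index set\<close>

lemma inj_on_lattice_param:
  "inj_on (\<lambda>(k::int, \<epsilon>::real). \<epsilon> * q powi k * \<gamma>) (UNIV \<times> {1, -1})"
proof (rule inj_onI, clarify)
  fix k l :: int and \<epsilon> \<delta> :: real
  assume e: "\<epsilon> \<in> {1, -1}" "\<delta> \<in> {1, -1}" and eq: "\<epsilon> * q powi k * \<gamma> = \<delta> * q powi l * \<gamma>"
  have eq': "\<epsilon> * q powi k = \<delta> * q powi l"
    using eq \<gamma>_pos by simp
  have "\<bar>\<epsilon> * q powi k\<bar> = \<bar>\<delta> * q powi l\<bar>"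
    using eq' by simp
  then have "q powi k = q powi l"
    using e q_pos by (auto simp: abs_mult)
  moreover have "q powi m \<noteq> q powi n" if "m < n" for m n :: int
    using power_int_strict_decreasing[OF that q_pos q_less_1] by simp
  ultimately have "k = l"
    by (metis linorder_neqE)
  then show "k = l \<and> \<epsilon> = \<delta>"
    using eq' q_pos by simp
qed

text \<open>Turns sums over exponent and sign into sums over the set \<open>L\<close>, where scaling
  by \<open>q\<close> is a change of variable.\<close>

lemma bij_betw_lattice_param:
  "bij_betw (\<lambda>(k::int, \<epsilon>::real). \<epsilon> * q powi k * \<gamma>) (UNIV \<times> {1, -1}) L"
  using inj_on_lattice_param by (auto simp: bij_betw_def qlattice_def image_iff; force)

lemma zero_notin_lattice: "0 \<notin> L"
  using q_pos \<gamma>_pos by (auto simp: qlattice_def)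

lemma bij_betw_lattice_scale: "bij_betw (\<lambda>x. q * x) L L"
  unfolding bij_betw_def
proof
  show "inj_on (\<lambda>x. q * x) L"
    using q_pos by (auto intro: inj_onI)
  have "q * (\<epsilon> * q powi k * \<gamma>) = \<epsilon> * q powi (k + 1) * \<gamma>" for \<epsilon> k
    using q_pos by (simp add: power_int_add)
  moreover have "\<epsilon> * q powi k * \<gamma> = q * (\<epsilon> * q powi (k - 1) * \<gamma>)" for \<epsilon> k
    using q_pos by (simp add: power_int_diff)
  ultimately show "(\<lambda>x. q * x) ` L = L"
    unfolding qlattice_def image_def by blast
qed

lemma lattice_scale: "x \<in> L \<Longrightarrow> q * x \<in> L"
  using bij_betw_lattice_scale bij_betwE by fastforce

text \<open>Near 0 the lattice consists of two geometric progressions, one for each sign. Their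
  finite mass serves to control moments of order 0.\<close>

lemma summable_small_lattice: "(\<lambda>x. \<bar>x\<bar>) summable_on {x\<in>L. \<bar>x\<bar> \<le> 1}"
proof -
  obtain m :: nat where "q ^ m < \<gamma>"
    using real_arch_pow_inv[OF \<gamma>_pos q_less_1] by auto
  then have m: "q powi (- int m) * \<gamma> \<ge> 1"
    using q_pos by (simp add: power_int_minus field_simps)
  \<comment> \<open>By the choice of \<open>m\<close>, all lattice points with \<bar>x\<bar> \<le> 1
    have exponent at least \<open>- int m\<close>, so natural numbers can index a set containing
    them.\<close>
  define P where "P = (\<lambda>(n::nat, \<epsilon>::real). \<epsilon> * q powi (int n - int m) * \<gamma>)"
  have "{x\<in>L. \<bar>x\<bar> \<le> 1} \<subseteq> P ` (UNIV \<times> {1, -1})"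
  proof
    fix x assume "x \<in> {x\<in>L. \<bar>x\<bar> \<le> 1}"
    then obtain \<epsilon> k where x: "x = \<epsilon> * q powi k * \<gamma>" "\<epsilon> \<in> {1, -1}" "\<bar>x\<bar> \<le> 1"
      by (auto simp: qlattice_def)
    then have "q powi k * \<gamma> \<le> 1"
      using q_pos \<gamma>_pos by (auto simp: abs_mult)
    then have "q powi k \<le> q powi (- int m)"
      using m \<gamma>_pos by (meson mult_le_cancel_right_pos order_trans)
    then have "- int m \<le> k"
      using power_int_strict_decreasing[OF _ q_pos q_less_1, of k "- int m"] by force
    then have "x = P (nat (k + int m), \<epsilon>)"
      using x by (simp add: P_def)
    then show "x \<in> P ` (UNIV \<times> {1, -1})"
      using x(2) by blast
  qed
  moreover have "(\<lambda>x. \<bar>x\<bar>) summable_on P ` (UNIV \<times> {1, -1})"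
  proof (rule summable_on_reindex[THEN iffD2])
    show "inj_on P (UNIV \<times> {1, -1})"
    proof (rule inj_onI, clarify)
      fix a b :: nat and \<epsilon> \<delta> :: real
      assume "\<epsilon> \<in> {1, -1}" "\<delta> \<in> {1, -1}" "P (a, \<epsilon>) = P (b, \<delta>)"
      then show "a = b \<and> \<epsilon> = \<delta>"
        using inj_onD[OF inj_on_lattice_param, of "(int a - int m, \<epsilon>)" "(int b - int m, \<delta>)"]
        by (auto simp: P_def)
    qed
    have *: "(\<lambda>n. q powi (int n - int m) * \<gamma>) summable_on (UNIV :: nat set)"
    proof -
      have "(\<lambda>n. q ^ n * (q powi (- int m) * \<gamma>)) summable_on (UNIV :: nat set)"
        using q_pos q_less_1
        by (intro summable_on_cmult_left norm_summable_imp_summable_on) simp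
      then show ?thesis
        using q_pos by (simp add: power_int_diff power_int_minus field_simps)
    qed
    have "((\<lambda>x. \<bar>x\<bar>) \<circ> P) summable_on (UNIV \<times> {\<epsilon>})" if "\<epsilon> \<in> {1, -1}" for \<epsilon>
    proof -
      have "bij_betw (\<lambda>n. (n, \<epsilon>)) (UNIV::nat set) (UNIV \<times> {\<epsilon>})"
        by (auto simp: bij_betw_def inj_on_def)
      from summable_on_reindex_bij_betw[OF this, of "(\<lambda>x. \<bar>x\<bar>) \<circ> P"] show ?thesis
        using * that q_pos \<gamma>_pos by (auto simp: P_def abs_mult)
    qed
    then have "((\<lambda>x. \<bar>x\<bar>) \<circ> P) summable_on (UNIV \<times> {1} \<union> UNIV \<times> {-1})"
      by (intro summable_on_Un_disjoint) auto
    then show "((\<lambda>x. \<bar>x\<bar>) \<circ> P) summable_on (UNIV \<times> {1, -1})"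
      by (rule back_subst[where P = "\<lambda>A. _ summable_on A"]) auto
  qed
  ultimately show ?thesis
    by (rule summable_on_subset_banach[rotated])
qed

section \<open>Absolute moments as weighted sums over the lattice\<close>

definition wsummable :: "nat \<Rightarrow> (real \<Rightarrow> complex) \<Rightarrow> bool" where
  "wsummable e h \<longleftrightarrow> (\<lambda>x. \<bar>x\<bar> ^ Suc e * cmod (h x)) summable_on L"

definition wnorm :: "nat \<Rightarrow> (real \<Rightarrow> complex) \<Rightarrow> real" where
  "wnorm e h = (\<Sum>\<^sub>\<infinity>x\<in>L. \<bar>x\<bar> ^ Suc e * cmod (h x))"

text \<open>The q-integral gives the point \<open>x\<close> the weight \<bar>x\<bar>; this is the
  extra factor behind \<open>Suc e\<close> in \<open>wsummable\<close> and
  \<open>wnorm\<close>.\<close>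

lemma norm_qintegrand:
  assumes "p \<in> UNIV \<times> {1, -1}"
  shows "norm (qintegrand q \<gamma> (\<lambda>x. f x * of_real x ^ e) p) =
    (\<lambda>x. \<bar>x\<bar> ^ Suc e * cmod (f x)) ((\<lambda>(k, \<epsilon>). \<epsilon> * q powi k * \<gamma>) p)"
  using assms q_pos \<gamma>_pos
  by (auto simp: qintegrand_def norm_mult norm_power norm_power_int abs_mult power_mult_distrib)

lemma qintegrable_iff: "qintegrable q \<gamma> (\<lambda>x. f x * of_real x ^ e) \<longleftrightarrow> wsummable e f"
  unfolding qintegrable_def wsummable_def summable_on_reindex_bij_betw[OF bij_betw_lattice_param, symmetric]
  by (rule summable_on_cong) (rule norm_qintegrand)

lemma infsum_norm_qintegrand:
  "(\<Sum>\<^sub>\<infinity>p\<in>UNIV \<times> {1, -1}. norm (qintegrand q \<gamma> (\<lambda>x. f x * of_real x ^ e) p)) = wnorm e f"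
  unfolding wnorm_def infsum_reindex_bij_betw[OF bij_betw_lattice_param, symmetric]
  by (rule infsum_cong) (rule norm_qintegrand)

lemma qabs_moment_eq:
  "qabs_moment q \<gamma> e f = q powr ((real e ^ 2 + real e) / 2) * ((1 - q) * wnorm e f)"
proof -
  have "qintegrand q \<gamma> (\<lambda>x. cmod (f x * of_real x ^ e)) p =
      norm (qintegrand q \<gamma> (\<lambda>x. f x * of_real x ^ e) p)" for p
    using q_pos \<gamma>_pos by (cases p) (auto simp: qintegrand_def)
  then show ?thesis
    by (simp add: qabs_moment_def qint_def flip: infsum_norm_qintegrand)
qed

lemma wnorm_nonneg: "0 \<le> wnorm e f"
  unfolding wnorm_def by (intro infsum_nonneg) simp

lemma qabs_moment_nonneg: "0 \<le> qabs_moment q \<gamma> e f"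
  using q_less_1 wnorm_nonneg by (simp add: qabs_moment_eq)

lemma norm_qmoment_le: "wsummable e f \<Longrightarrow> cmod (qmoment q \<gamma> e f) \<le> qabs_moment q \<gamma> e f"
  using norm_infsum_bound[of "qintegrand q \<gamma> (\<lambda>x. f x * of_real x ^ e)" "UNIV \<times> {1, -1}"] q_less_1
  by (auto simp: qmoment_def qabs_moment_eq qint_def norm_mult infsum_norm_qintegrand
      qintegrable_iff[symmetric] qintegrable_def intro!: mult_left_mono)

text \<open>Dividing by \<open>x\<close> uses up one power of \<bar>x\<bar>, leaving the terms of
  \<open>h\<close> at \<open>x\<close> and at \<open>q * x\<close>. Substituting in the latter costs
  the factor \<open>1 / q ^ Suc e\<close>, which the normalisation of the moments repays.\<close>

lemma wnorm_qderiv: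
  assumes "wsummable e h"
  shows "wsummable (Suc e) (qderiv q h)"
    and "qabs_moment q \<gamma> (Suc e) (qderiv q h) \<le> 2 / (1 - q) * qabs_moment q \<gamma> e h"
proof -
  let ?u = "\<lambda>x. \<bar>x\<bar> ^ Suc e * cmod (h x)"
  let ?v = "\<lambda>x. \<bar>x\<bar> ^ Suc e * cmod (h (q * x))"
  have v: "?v x = ?u (q * x) / q ^ Suc e" for x
    using q_pos by (simp add: abs_mult power_mult_distrib)
  have su: "?u summable_on L"
    using assms by (simp add: wsummable_def)
  have suq: "(\<lambda>x. ?u (q * x)) summable_on L"
    using su summable_on_reindex_bij_betw[OF bij_betw_lattice_scale, of ?u] by simp
  have infq: "(\<Sum>\<^sub>\<infinity>x\<in>L. ?u (q * x)) = wnorm e h"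
    using infsum_reindex_bij_betw[OF bij_betw_lattice_scale, of ?u] by (simp add: wnorm_def)
  have sv: "?v summable_on L"
    unfolding v divide_inverse by (intro summable_on_cmult_left suq)
  have iv: "(\<Sum>\<^sub>\<infinity>x\<in>L. ?v x) = wnorm e h / q ^ Suc e"
    unfolding v divide_inverse by (subst infsum_cmult_left) (use suq infq in auto)
  have sb: "(\<lambda>x. (?u x + ?v x) * inverse (1 - q)) summable_on L"
    by (intro summable_on_cmult_left summable_on_add su sv)
  have bd: "\<bar>x\<bar> ^ Suc (Suc e) * cmod (qderiv q h x) \<le> (?u x + ?v x) * inverse (1 - q)"
    if "x \<in> L" for x
  proof -
    have x: "x \<noteq> 0"
      using that zero_notin_lattice by auto
    have "cmod (qderiv q h x) = cmod (h x - h (q * x)) / ((1 - q) * \<bar>x\<bar>)"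
      using q_less_1 by (simp add: qderiv_def norm_divide norm_mult abs_mult del: of_real_diff of_real_mult)
    also have "\<dots> \<le> (cmod (h x) + cmod (h (q * x))) / ((1 - q) * \<bar>x\<bar>)"
      using q_less_1 by (intro divide_right_mono norm_triangle_ineq4) auto
    finally have "\<bar>x\<bar> ^ Suc (Suc e) * cmod (qderiv q h x)
        \<le> \<bar>x\<bar> ^ Suc (Suc e) * ((cmod (h x) + cmod (h (q * x))) / ((1 - q) * \<bar>x\<bar>))"
      by (intro mult_left_mono) auto
    also have "\<dots> = (?u x + ?v x) * inverse (1 - q)"
      using x q_less_1 by (simp add: field_simps)
    finally show ?thesis .
  qed
  show s: "wsummable (Suc e) (qderiv q h)"
    unfolding wsummable_def
    by (rule summable_on_comparison_test[OF sb bd]) auto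
  have "wnorm (Suc e) (qderiv q h) \<le> (\<Sum>\<^sub>\<infinity>x\<in>L. (?u x + ?v x) * inverse (1 - q))"
    unfolding wnorm_def by (rule infsum_mono[OF s[unfolded wsummable_def] sb bd])
  also have "\<dots> = (wnorm e h + wnorm e h / q ^ Suc e) * inverse (1 - q)"
    by (subst infsum_cmult_left) (use su sv iv in \<open>simp_all add: infsum_add wnorm_def summable_on_add\<close>)
  finally have W: "wnorm (Suc e) (qderiv q h) \<le> (wnorm e h + wnorm e h / q ^ Suc e) * inverse (1 - q)" .
  \<comment> \<open>The two quadratic exponents differ by exactly e + 1; this cancels the cost of
    the substitution and makes the final constant independent of \<open>e\<close>.\<close>
  have p: "q powr ((real (Suc e) ^ 2 + real (Suc e)) / 2)
      = q powr ((real e ^ 2 + real e) / 2) * q ^ Suc e"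
    using q_pos by (simp add: powr_realpow[symmetric] powr_add[symmetric] power2_eq_square field_simps del: power_Suc)
  have "qabs_moment q \<gamma> (Suc e) (qderiv q h) \<le> q powr ((real e ^ 2 + real e) / 2) * q ^ Suc e *
     ((1 - q) * ((wnorm e h + wnorm e h / q ^ Suc e) * inverse (1 - q)))"
    unfolding qabs_moment_eq p
    using q_pos q_less_1 by (intro mult_left_mono W) auto
  also have "\<dots> = q powr ((real e ^ 2 + real e) / 2) * wnorm e h * (q ^ Suc e + 1)"
    using q_pos q_less_1 by (simp add: field_simps)
  also have "\<dots> \<le> q powr ((real e ^ 2 + real e) / 2) * wnorm e h * 2"
    using q_pos q_less_1 wnorm_nonneg power_le_one[of q "Suc e"]
    by (intro mult_left_mono) auto
  also have "\<dots> = 2 / (1 - q) * qabs_moment q \<gamma> e h"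
    using q_less_1 by (simp add: qabs_moment_eq)
  finally show "qabs_moment q \<gamma> (Suc e) (qderiv q h) \<le> 2 / (1 - q) * qabs_moment q \<gamma> e h" .
qed

section \<open>Uniform bounds and moments of iterated q-derivatives\<close>

definition small_mass :: real where
  "small_mass = (\<Sum>\<^sub>\<infinity>x\<in>{x\<in>L. \<bar>x\<bar> \<le> 1}. \<bar>x\<bar>)"

text \<open>Lowering the order stops at 0, so order 0 is recovered from order 1: where \<bar>x\<bar>
  \<le> 1 the uniform bound and the finite mass suffice, elsewhere \<bar>x\<bar> \<le>
  \<bar>x\<bar>^2.\<close>

lemma wnorm_0_le:
  assumes "wsummable 1 h" and B: "\<And>x. x \<in> L \<Longrightarrow> cmod (h x) \<le> B"
  shows "wsummable 0 h" and "wnorm 0 h \<le> B * small_mass + wnorm 1 h"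
proof -
  let ?S = "{x\<in>L. \<bar>x\<bar> \<le> 1}"
  let ?a = "\<lambda>x. if \<bar>x\<bar> \<le> 1 then B * \<bar>x\<bar> else 0"
  let ?b = "\<lambda>x. \<bar>x\<bar> ^ Suc 1 * cmod (h x)"
  have aS: "?a summable_on L \<longleftrightarrow> (\<lambda>x. B * \<bar>x\<bar>) summable_on ?S"
    by (rule summable_on_cong_neutral) auto
  have a: "?a summable_on L"
    unfolding aS by (intro summable_on_cmult_right summable_small_lattice)
  have ia: "infsum ?a L = B * small_mass"
  proof -
    have "infsum ?a L = (\<Sum>\<^sub>\<infinity>x\<in>?S. B * \<bar>x\<bar>)"
      by (rule infsum_cong_neutral) auto
    then show ?thesis
      by (simp add: infsum_cmult_right summable_small_lattice small_mass_def)
  qed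
  have b: "?b summable_on L"
    using assms by (simp add: wsummable_def)
  have bd: "\<bar>x\<bar> ^ Suc 0 * cmod (h x) \<le> ?a x + ?b x" if "x \<in> L" for x
  proof (cases "\<bar>x\<bar> \<le> 1")
    case True
    then show ?thesis
      using mult_left_mono[OF B[OF that], of "\<bar>x\<bar>"] by (simp add: mult.commute add_increasing2)
  next
    case False
    then have "\<bar>x\<bar> * cmod (h x) * 1 \<le> \<bar>x\<bar> * cmod (h x) * \<bar>x\<bar>"
      by (intro mult_left_mono) auto
    with False show ?thesis
      by (simp add: mult_ac)
  qed
  have ab: "(\<lambda>x. ?a x + ?b x) summable_on L"
    by (rule summable_on_add[OF a b])
  show s: "wsummable 0 h"
    unfolding wsummable_def by (rule summable_on_comparison_test[OF ab bd]) auto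
  have "wnorm 0 h \<le> (\<Sum>\<^sub>\<infinity>x\<in>L. ?a x + ?b x)"
    unfolding wnorm_def by (rule infsum_mono[OF s[unfolded wsummable_def] ab bd])
  also have "\<dots> = B * small_mass + wnorm 1 h"
    unfolding infsum_add[OF a b] ia wnorm_def ..
  finally show "wnorm 0 h \<le> B * small_mass + wnorm 1 h" .
qed


text \<open>Near 0 the holomorphic estimate applies. Away from 0 the denominator of the quotient is
  at least \<open>(1 - q) * s\<close>, which gives the same factor per step. Since
  \<open>q * x\<close> may fall in either region, the induction runs over all of
  \<open>L\<close>.\<close>

lemma qderiv_iterate_bounded:
  assumes h0: "wsummable 0 h" and F: "F holomorphic_on ball 0 r" "0 < r"
    and hF: "\<And>x. x \<in> L \<Longrightarrow> \<bar>x\<bar> < r \<Longrightarrow> h x = F (of_real x)"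
  obtains M w where "0 < M" "0 < w" "\<And>n x. x \<in> L \<Longrightarrow> cmod ((qderiv q ^^ n) h x) \<le> M * w ^ n"
proof -
  define s where "s = r / 2"
  have s: "0 < s" "s < r" using F(2) by (auto simp: s_def)
  have ball_q: "of_real q * z \<in> ball 0 r" if "z \<in> ball 0 r" for z :: complex
    by (rule convex_qscale[OF convex_ball]) (use F(2) q_pos q_less_1 that in auto)
  have cball_q: "of_real q * z \<in> cball 0 s" if "z \<in> cball 0 s" for z :: complex
    by (rule convex_qscale[OF convex_cball]) (use s q_pos q_less_1 that in auto)
  have sub: "cball 0 s \<subseteq> ball (0::complex) r"
    using s by auto
  have "compact (F ` cball 0 s)"
    using F(1) sub by (intro compact_continuous_image holomorphic_on_imp_continuous_on)
      (auto intro: holomorphic_on_subset)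
  then have "bounded (F ` cball 0 s)"
    by (rule compact_imp_bounded)
  then obtain M0 where M0: "0 < M0" "\<And>z. z \<in> cball 0 s \<Longrightarrow> cmod (F z) \<le> M0"
    unfolding bounded_pos by blast
  \<comment> \<open>The second summand bounds \<open>h\<close> where \<bar>x\<bar> > s, because each
    single term of the sum \<open>wnorm 0 h\<close> is at most the whole.\<close>
  define M where "M = M0 + wnorm 0 h / s"
  define w where "w = 2 / ((1 - q) * s)"
  have M: "0 < M" "M0 \<le> M" "wnorm 0 h / s \<le> M"
    using M0 wnorm_nonneg[of 0 h] s by (auto simp: M_def add_pos_nonneg)
  have w: "0 < w"
    using s q_less_1 by (simp add: w_def)
  have near: "cmod ((qderiv q ^^ n) h x) \<le> M * w ^ n" if x: "x \<in> L" "\<bar>x\<bar> \<le> s" for n x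
  proof -
    have "(qderiv q ^^ n) h x = (cqderiv q ^^ n) F (of_real x)"
    proof (rule qderiv_iterate_eq_cqderiv[where S = "{x \<in> L. \<bar>x\<bar> < r}"])
      fix y assume "y \<in> {x \<in> L. \<bar>x\<bar> < r}"
      then show "q * y \<in> {x \<in> L. \<bar>x\<bar> < r}"
        using ball_q[of "of_real y"] lattice_scale by (auto simp: norm_mult abs_mult)
    qed (use x s hF zero_notin_lattice in auto)
    also have "cmod \<dots> \<le> w ^ n * M"
      unfolding w_def
      by (rule cqderiv_iterate(2)[OF F(1) open_ball q_pos q_less_1 ball_q sub subset_refl s(1) cball_q])
        (use M0 M x in \<open>auto intro: order_trans\<close>)
    finally show ?thesis
      by (simp add: mult.commute)
  qed
  have "cmod ((qderiv q ^^ n) h x) \<le> M * w ^ n" if "x \<in> L" for n x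
    using that
  proof (induction n arbitrary: x)
    case 0
    show ?case
    proof (cases "\<bar>x\<bar> \<le> s")
      case False
      have "s * cmod (h x) \<le> \<bar>x\<bar> ^ Suc 0 * cmod (h x)"
        using False by (intro mult_right_mono) auto
      also have "\<dots> \<le> wnorm 0 h"
        unfolding wnorm_def
        using finite_sum_le_infsum[OF h0[unfolded wsummable_def], of "{x}"] 0 by simp
      also have "\<dots> \<le> s * M"
        using M(3) s by (simp add: field_simps)
      finally show ?thesis
        using s by simp
    qed (use near[OF 0, of 0] in auto)
  next
    case (Suc n)
    show ?case
    proof (cases "\<bar>x\<bar> \<le> s")
      case False
      let ?d = "(qderiv q ^^ n) h"
      have "cmod ((qderiv q ^^ Suc n) h x) = cmod (?d x - ?d (q * x)) / ((1 - q) * \<bar>x\<bar>)"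
        using q_less_1 by (simp add: qderiv_def norm_divide norm_mult abs_mult del: of_real_diff of_real_mult)
      also have "\<dots> \<le> (M * w ^ n + M * w ^ n) / ((1 - q) * s)"
        using Suc.IH[OF Suc.prems] Suc.IH[OF lattice_scale[OF Suc.prems]] False s q_less_1 M(1) w
          norm_triangle_ineq4[of "?d x" "?d (q * x)"]
        by (intro frac_le mult_left_mono) auto
      also have "\<dots> = M * w ^ Suc n"
        by (simp add: w_def mult_ac)
      finally show ?thesis .
    qed (use near[OF Suc.prems, of "Suc n"] in auto)
  qed
  with M w that show ?thesis by blast
qed

text \<open>Positive orders come from the order below for the previous iterate; order 0 comes from
  order 1 of the same iterate together with the uniform bound.\<close>

lemma wsummable_qderiv_iterate:
  assumes "\<And>e. wsummable e h"
    and B: "\<And>n x. x \<in> L \<Longrightarrow> cmod ((qderiv q ^^ n) h x) \<le> M * w ^ n"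
  shows "wsummable e ((qderiv q ^^ n) h)"
proof (induction n arbitrary: e)
  case 0
  then show ?case using assms by simp
next
  case (Suc n)
  have pos: "wsummable (Suc e) ((qderiv q ^^ Suc n) h)" for e
    using wnorm_qderiv(1)[OF Suc] by simp
  show ?case
  proof (cases e)
    case 0
    show ?thesis
      unfolding 0 by (rule wnorm_0_le(1)[OF _ B]) (use pos[of 0] in auto)
  qed (use pos in auto)
qed

text \<open>Each \<open>q\<close>-derivative lowers the order of the moment by one; once the order is \<open>0\<close>, the
  truncated difference \<open>e - n\<close> stays \<open>0\<close> and only the uniform bound on the derivatives is used.\<close>

lemma qabs_moment_qderiv_iterate_le:
  assumes ws: "\<And>e. wsummable e h" and "0 < M" "0 < w"
    and B: "\<And>n x. x \<in> L \<Longrightarrow> cmod ((qderiv q ^^ n) h x) \<le> M * w ^ n"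
    and C: "0 < C" "\<And>e. \<bar>qabs_moment q \<gamma> e h\<bar> \<le> C * (q powr (\<beta> * real e ^ 2 / 2) * d ^ e)"
  obtains K c where "0 < K" "0 < c"
    "\<And>n e. qabs_moment q \<gamma> e ((qderiv q ^^ n) h)
       \<le> K * c ^ n * (q powr (\<beta> * real (e - n) ^ 2 / 2) * d ^ (e - n))"
proof -
  \<comment> \<open>\<open>c0\<close> is the cost of lowering the order by one, and \<open>t\<close>
    that of bounding order 0 through order 1. The factor 2 in \<open>c\<close> and in
    \<open>K\<close> leaves half of the target for each of the two contributions at order 0.\<close>
  define c0 where "c0 = 2 / (1 - q)"
  define t where "t = c0 / q"
  define c where "c = w + 2 * t + c0"
  define D where "D = (1 - q) * M * small_mass"
  define K where "K = 2 * D + C"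
  have c0: "0 < c0"
    using q_less_1 by (simp add: c0_def)
  then have "0 < t"
    using q_pos by (simp add: t_def)
  with c0 have "w \<le> c \<and> t \<le> c / 2 \<and> c0 \<le> c \<and> 0 < c"
    using \<open>0 < w\<close> by (simp add: c_def)
  then have c: "w \<le> c" "c0 / q \<le> c / 2" "c0 \<le> c" "0 < c"
    by (auto simp: t_def)
  have "0 \<le> small_mass"
    unfolding small_mass_def by (rule infsum_nonneg) simp
  then have D: "0 \<le> D"
    using q_less_1 \<open>0 < M\<close> by (simp add: D_def)
  then have K: "0 < K" "D \<le> K / 2" "C \<le> K"
    using C by (auto simp: K_def)
  note ws' = wsummable_qderiv_iterate[OF ws B]
  have step: "qabs_moment q \<gamma> (Suc e) ((qderiv q ^^ Suc n) h)
      \<le> c0 * qabs_moment q \<gamma> e ((qderiv q ^^ n) h)" for n e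
    using wnorm_qderiv(2)[OF ws'] by (simp add: c0_def)
  \<comment> \<open>The division by \<open>q\<close> appears because order 1 is normalised by
    \<open>q\<close> and order 0 by 1.\<close>
  have zero: "qabs_moment q \<gamma> 0 ((qderiv q ^^ n) h)
      \<le> D * w ^ n + qabs_moment q \<gamma> 1 ((qderiv q ^^ n) h) / q" for n
  proof -
    have "(1 - q) * wnorm 0 ((qderiv q ^^ n) h)
        \<le> (1 - q) * (M * w ^ n * small_mass + wnorm 1 ((qderiv q ^^ n) h))"
      using q_less_1 by (intro mult_left_mono wnorm_0_le(2)[OF ws' B]) auto
    moreover have "qabs_moment q \<gamma> 1 ((qderiv q ^^ n) h) / q = (1 - q) * wnorm 1 ((qderiv q ^^ n) h)"
      using q_pos by (simp add: qabs_moment_eq)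
    moreover have "qabs_moment q \<gamma> 0 ((qderiv q ^^ n) h) = (1 - q) * wnorm 0 ((qderiv q ^^ n) h)"
      using q_pos by (simp add: qabs_moment_eq)
    moreover have "(1 - q) * (M * w ^ n * small_mass) = D * w ^ n"
      by (simp add: D_def)
    ultimately show ?thesis
      by (simp only: distrib_left)
  qed
  have "qabs_moment q \<gamma> e ((qderiv q ^^ n) h)
      \<le> K * c ^ n * (q powr (\<beta> * real (e - n) ^ 2 / 2) * d ^ (e - n))" for n e
  proof (induction n arbitrary: e)
    case 0
    \<comment> \<open>The sign of \<open>d\<close> is not fixed here; nonnegativity follows because
      the expression dominates an absolute value.\<close>
    have "0 \<le> C * (q powr (\<beta> * real e ^ 2 / 2) * d ^ e)"
      using C(2)[of e] by linarith
    then have "0 \<le> q powr (\<beta> * real e ^ 2 / 2) * d ^ e"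
      using C(1) by (simp add: zero_le_mult_iff)
    then have "C * (q powr (\<beta> * real e ^ 2 / 2) * d ^ e) \<le> K * (q powr (\<beta> * real e ^ 2 / 2) * d ^ e)"
      using K(3) by (intro mult_right_mono) auto
    then show ?case
      using C(2)[of e] by simp
  next
    case (Suc n)
    show ?case
    proof (cases e)
      case 0
      have "qabs_moment q \<gamma> 1 ((qderiv q ^^ Suc n) h) / q
          \<le> c0 * qabs_moment q \<gamma> 0 ((qderiv q ^^ n) h) / q"
        using step[of 0 n] q_pos by (intro divide_right_mono) auto
      also have "\<dots> = c0 / q * qabs_moment q \<gamma> 0 ((qderiv q ^^ n) h)"
        by simp
      also have "\<dots> \<le> c / 2 * (K * c ^ n)"
        using Suc[of 0] c K qabs_moment_nonneg q_pos by (intro mult_mono) auto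
      also have "\<dots> = K / 2 * c ^ Suc n"
        by simp
      finally have 1: "qabs_moment q \<gamma> 1 ((qderiv q ^^ Suc n) h) / q \<le> K / 2 * c ^ Suc n" .
      have 2: "D * w ^ Suc n \<le> K / 2 * c ^ Suc n"
        using K D c \<open>0 < w\<close> by (intro mult_mono power_mono) auto
      have "qabs_moment q \<gamma> e ((qderiv q ^^ Suc n) h) \<le> K * c ^ Suc n"
        unfolding 0 using zero[of "Suc n"] 1 2 by linarith
      then show ?thesis
        using q_pos 0 by simp
    next
      case (Suc e')
      \<comment> \<open>Here \<open>e - Suc n = e' - n\<close>, so the Gaussian factor is unchanged
        and only one more \<open>c\<close> is needed.\<close>
      have "qabs_moment q \<gamma> e ((qderiv q ^^ Suc n) h) \<le> c0 * qabs_moment q \<gamma> e' ((qderiv q ^^ n) h)"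
        using step Suc by simp
      also have "\<dots> \<le> c * (K * c ^ n * (q powr (\<beta> * real (e' - n) ^ 2 / 2) * d ^ (e' - n)))"
        using Suc.IH[of e'] c c0 qabs_moment_nonneg by (intro mult_mono) auto
      finally show ?thesis
        using Suc by (simp add: mult_ac)
    qed
  qed
  with K c that show ?thesis by blast
qed

text \<open>Half of the Gaussian decay of \<open>a\<close> makes the series in \<open>n\<close>
  converge; the other half joins the decay of \<open>h\<close> at \<open>e - n\<close> to give decay
  in \<open>e\<close>. Sums over finite subsets of \<open>L\<close> allow the interchange of
  summations.\<close>

lemma gaussian_series_moments:
  fixes a :: "nat \<Rightarrow> complex"
  assumes ws: "\<And>e. wsummable e h" and M: "0 < M" "0 < w"
    and B: "\<And>n x. x \<in> L \<Longrightarrow> cmod ((qderiv q ^^ n) h x) \<le> M * w ^ n"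
    and h: "gaussian_bounded q (\<lambda>e. qabs_moment q \<gamma> e h)"
    and a: "gaussian_bounded q (\<lambda>e. cmod (a e))"
    and u: "\<And>x. x \<in> L \<Longrightarrow> u x = (\<Sum>n. a n * (qderiv q ^^ n) h x)"
    and conv: "\<And>x. x \<in> L \<Longrightarrow> summable (\<lambda>n. cmod (a n * (qderiv q ^^ n) h x))"
  shows "wsummable e u" and "gaussian_bounded q (\<lambda>e. qabs_moment q \<gamma> e u)"
proof -
  obtain \<alpha> b A where A: "0 < \<alpha>" "0 < b" "0 < A"
    "\<And>n. \<bar>cmod (a n)\<bar> \<le> A * (q powr (\<alpha> * real n ^ 2 / 2) * b ^ n)"
    using a unfolding gaussian_bounded_def by blast
  obtain \<beta> d C where C: "0 < \<beta>" "0 < d" "0 < C"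
    "\<And>e. \<bar>qabs_moment q \<gamma> e h\<bar> \<le> C * (q powr (\<beta> * real e ^ 2 / 2) * d ^ e)"
    using h unfolding gaussian_bounded_def by blast
  obtain K c where K: "0 < K" "0 < c" and Kc:
    "\<And>n e. qabs_moment q \<gamma> e ((qderiv q ^^ n) h)
       \<le> K * c ^ n * (q powr (\<beta> * real (e - n) ^ 2 / 2) * d ^ (e - n))"
    using qabs_moment_qderiv_iterate_le[OF ws M B C(3,4)] by blast
  note ws' = wsummable_qderiv_iterate[OF ws B]
  define \<delta> where "\<delta> = min (\<alpha> / 2) \<beta>"
  have \<delta>: "0 < \<delta>" "\<delta> \<le> \<alpha> / 2" "\<delta> \<le> \<beta>"
    using A C by (auto simp: \<delta>_def)
  define s where "s n = q powr (\<alpha> / 2 * real n ^ 2 / 2) * (b * c) ^ n" for n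
  \<comment> \<open>The base \<open>max d 1\<close> bounds \<open>d ^ (e - n)\<close> by a power
    with exponent \<open>e\<close>, also when d < 1.\<close>
  define G where "G e = A * K * (q powr (\<delta> / 2 * real e ^ 2 / 2) * (max d 1) ^ e)" for e :: nat
  have s: "summable s" "\<And>n. 0 \<le> s n"
    using summable_gaussian[of q "\<alpha> / 2" "b * c"] q_pos q_less_1 A K unfolding s_def by (blast intro: mult_pos_pos half_gt_zero, auto)
  \<comment> \<open>Even with truncated subtraction e \<le> n + (e - n); then (x + y)^2 \<le> 2 (x^2
    + y^2), which is where half of \<delta> is lost.\<close>
  have exponent: "\<delta> / 2 * real e ^ 2 / 2 \<le> \<alpha> / 2 * real n ^ 2 / 2 + \<beta> * real (e - n) ^ 2 / 2" for e n
  proof -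
    have "real e ^ 2 \<le> (real n + real (e - n)) ^ 2"
      by (intro power_mono) auto
    also have "\<dots> \<le> 2 * (real n ^ 2 + real (e - n) ^ 2)"
      using sum_squares_bound[of "real n" "real (e - n)"] by (simp add: power2_sum)
    finally have "\<delta> * real e ^ 2 \<le> \<delta> * (2 * (real n ^ 2 + real (e - n) ^ 2))"
      using \<delta> by (intro mult_left_mono) auto
    moreover have "\<delta> * real n ^ 2 \<le> \<alpha> / 2 * real n ^ 2" "\<delta> * real (e - n) ^ 2 \<le> \<beta> * real (e - n) ^ 2"
      by (rule mult_right_mono[OF \<delta>(2)] mult_right_mono[OF \<delta>(3)]; simp)+
    ultimately show ?thesis
      by (simp add: distrib_left)
  qed
  have le_Gs: "cmod (a n) * qabs_moment q \<gamma> e ((qderiv q ^^ n) h) \<le> G e * s n" for n e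
  proof -
    have "cmod (a n) * qabs_moment q \<gamma> e ((qderiv q ^^ n) h)
        \<le> (A * (q powr (\<alpha> * real n ^ 2 / 2) * b ^ n)) *
          (K * c ^ n * (q powr (\<beta> * real (e - n) ^ 2 / 2) * d ^ (e - n)))"
      using A(2,3) A(4)[of n] qabs_moment_nonneg by (intro mult_mono Kc) auto
    also have "\<dots> = A * K * ((q powr (\<alpha> / 2 * real n ^ 2 / 2) * q powr (\<beta> * real (e - n) ^ 2 / 2)) *
        d ^ (e - n)) * s n"
    proof -
      have "q powr (\<alpha> * real n ^ 2 / 2) = q powr (\<alpha> / 2 * real n ^ 2 / 2) * q powr (\<alpha> / 2 * real n ^ 2 / 2)"
        unfolding powr_add[symmetric] by (simp add: field_simps)
      then show ?thesis
        by (simp add: s_def power_mult_distrib mult_ac)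
    qed
    also have "\<dots> \<le> G e * s n"
    proof -
      have "q powr (\<alpha> / 2 * real n ^ 2 / 2) * q powr (\<beta> * real (e - n) ^ 2 / 2)
          \<le> q powr (\<delta> / 2 * real e ^ 2 / 2)"
        unfolding powr_add[symmetric] using exponent q_pos q_less_1 by (intro powr_mono') auto
      moreover have "d ^ (e - n) \<le> max d 1 ^ e"
        using C(2) power_mono[of d "max d 1" "e - n"] power_increasing[of "e - n" e "max d 1"] by auto
      ultimately show ?thesis
        unfolding G_def using A(3) K(1) C(2) s(2)
        by (intro mult_right_mono mult_left_mono mult_mono) auto
    qed
    finally show ?thesis .
  qed
  define p where "p e = q powr ((real e ^ 2 + real e) / 2) * (1 - q)" for e :: nat
  have p: "0 < p e" "qabs_moment q \<gamma> e f = p e * wnorm e f" for e f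
    using q_pos q_less_1 by (auto simp: p_def qabs_moment_eq)
  have sm: "summable (\<lambda>n. cmod (a n) * wnorm e ((qderiv q ^^ n) h))"
    and bd: "(\<Sum>n. cmod (a n) * wnorm e ((qderiv q ^^ n) h)) \<le> G e * suminf s / p e" for e
  proof -
    have le: "cmod (a n) * wnorm e ((qderiv q ^^ n) h) \<le> G e * s n / p e" for n
      using le_Gs[of n e] p(1)[of e] unfolding p(2) by (simp add: field_simps)
    have sG: "summable (\<lambda>n. G e * s n / p e)"
      by (intro summable_divide summable_mult s)
    show 1: "summable (\<lambda>n. cmod (a n) * wnorm e ((qderiv q ^^ n) h))"
      by (rule summable_comparison_test'[OF sG]) (use le wnorm_nonneg in \<open>auto simp: abs_mult\<close>)
    show "(\<Sum>n. cmod (a n) * wnorm e ((qderiv q ^^ n) h)) \<le> G e * suminf s / p e"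
      using suminf_le[OF le 1 sG] by (simp add: suminf_divide suminf_mult s summable_mult)
  qed
  \<comment> \<open>A finite sum commutes with the series, and the bound does not depend on
    \<open>P\<close>; it therefore gives both summability over \<open>L\<close> and the estimate of
    the full sum.\<close>
  have fin: "(\<Sum>x\<in>P. \<bar>x\<bar> ^ Suc e * cmod (u x)) \<le> G e * suminf s / p e"
    if P: "finite P" "P \<subseteq> L" for P e
  proof -
    let ?t = "\<lambda>x n. \<bar>x\<bar> ^ Suc e * cmod (a n * (qderiv q ^^ n) h x)"
    have st: "summable (?t x)" if "x \<in> P" for x
      using conv P that by (intro summable_mult) auto
    have "(\<Sum>x\<in>P. \<bar>x\<bar> ^ Suc e * cmod (u x)) \<le> (\<Sum>x\<in>P. \<Sum>n. ?t x n)"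
    proof (rule sum_mono)
      fix x assume "x \<in> P"
      then have x: "x \<in> L" using P by auto
      show "\<bar>x\<bar> ^ Suc e * cmod (u x) \<le> (\<Sum>n. ?t x n)"
        unfolding u[OF x] suminf_mult[OF conv[OF x]]
        by (intro mult_left_mono summable_norm conv x) auto
    qed
    also have "\<dots> = (\<Sum>n. \<Sum>x\<in>P. ?t x n)"
      by (rule suminf_sum[symmetric]) (rule st)
    also have "\<dots> \<le> (\<Sum>n. cmod (a n) * wnorm e ((qderiv q ^^ n) h))"
    proof (rule suminf_le[OF _ summable_sum[OF st] sm])
      fix n
      have "(\<Sum>x\<in>P. ?t x n) = cmod (a n) * (\<Sum>x\<in>P. \<bar>x\<bar> ^ Suc e * cmod ((qderiv q ^^ n) h x))"
        by (simp add: sum_distrib_left norm_mult mult_ac)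
      also have "\<dots> \<le> cmod (a n) * wnorm e ((qderiv q ^^ n) h)"
        unfolding wnorm_def
        by (intro mult_left_mono finite_sum_le_infsum ws'[unfolded wsummable_def] P) auto
      finally show "(\<Sum>x\<in>P. ?t x n) \<le> cmod (a n) * wnorm e ((qderiv q ^^ n) h)" .
    qed auto
    finally show ?thesis
      using bd[of e] by linarith
  qed
  show wsu: "wsummable e u" for e
    unfolding wsummable_def
    by (rule nonneg_bdd_above_summable_on; (rule bdd_aboveI2, rule fin)?) auto
  have "\<bar>qabs_moment q \<gamma> e u\<bar> \<le> (A * K * (suminf s + 1)) * (q powr (\<delta> / 2 * real e ^ 2 / 2) * (max d 1) ^ e)" for e
  proof -
    have "wnorm e u \<le> G e * suminf s / p e"
      unfolding wnorm_def
      by (rule infsum_le_finite_sums[OF wsu[unfolded wsummable_def]]) (rule fin)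
    then have "qabs_moment q \<gamma> e u \<le> G e * suminf s"
      unfolding p(2) using p(1)[of e] by (simp add: field_simps)
    \<comment> \<open>The added 1 makes positivity of the final constant immediate.\<close>
    also have "\<dots> \<le> G e * (suminf s + 1)"
      using A K C q_pos by (intro mult_left_mono) (auto simp: G_def)
    finally show ?thesis
      using qabs_moment_nonneg[of e u] by (simp add: G_def mult_ac)
  qed
  moreover have "0 < A * K * (suminf s + 1)"
    using A K suminf_nonneg[OF s] by (simp add: add_nonneg_pos)
  moreover have "0 < \<delta> / 2" "0 < max d 1"
    using \<delta>(1) by auto
  ultimately show "gaussian_bounded q (\<lambda>e. qabs_moment q \<gamma> e u)"
    unfolding gaussian_bounded_def by blast
qed

subsection \<open>The function classes and their convolution\<close>

lemma mem_I_infty_iff: "f \<in> I_infty q \<gamma> \<longleftrightarrow> (\<forall>x. x \<notin> L \<longrightarrow> f x = 0) \<and> (\<forall>e. wsummable e f)"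
  by (simp add: I_infty_def qintegrable_iff)

lemma mem_I_omega_iff:
  "f \<in> I_omega q \<gamma> \<longleftrightarrow> f \<in> I_infty q \<gamma> \<and> gaussian_bounded q (\<lambda>e. cmod (qmoment q \<gamma> e f))"
  by (simp add: I_omega_def gaussian_bounded_iff_bigo[OF q_pos])

lemma mem_I_s_omega_iff:
  "f \<in> I_s_omega q \<gamma> \<longleftrightarrow> f \<in> I_infty q \<gamma> \<and> gaussian_bounded q (\<lambda>e. qabs_moment q \<gamma> e f)"
  by (simp add: I_s_omega_def gaussian_bounded_iff_bigo[OF q_pos])

lemma I_s_omega_subset_I_omega: "I_s_omega q \<gamma> \<subseteq> I_omega q \<gamma>"
proof
  fix f assume f: "f \<in> I_s_omega q \<gamma>"
  then have "\<bar>cmod (qmoment q \<gamma> e f)\<bar> \<le> qabs_moment q \<gamma> e f" for e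
    by (simp add: mem_I_s_omega_iff mem_I_infty_iff norm_qmoment_le)
  with f show "f \<in> I_omega q \<gamma>"
    by (auto simp: mem_I_s_omega_iff mem_I_omega_iff elim: gaussian_bounded_mono)
qed

lemma HS_subset_HD: "HS q \<gamma> I \<subseteq> HD q \<gamma> I"
proof
  fix f assume "f \<in> HS q \<gamma> I"
  then obtain a F where f: "f \<in> I" "a > 0" "F holomorphic_on {z. \<bar>Im z\<bar> < a}"
    "\<forall>x\<in>L. f x = F (of_real x)"
    unfolding HS_def by blast
  have "ball 0 a \<subseteq> {z. \<bar>Im z\<bar> < a}"
    by (auto intro: le_less_trans[OF abs_Im_le_cmod])
  then have "F holomorphic_on ball 0 a"
    using f(3) holomorphic_on_subset by blast
  with f show "f \<in> HD q \<gamma> I"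
    unfolding HD_def by blast
qed

section \<open>Vector space structure of the strict classes\<close>

lemma wnorm_add:
  assumes "wsummable e f" "wsummable e g"
  shows "wsummable e (\<lambda>x. f x + g x)" and "wnorm e (\<lambda>x. f x + g x) \<le> wnorm e f + wnorm e g"
proof -
  let ?u = "\<lambda>x. \<bar>x\<bar> ^ Suc e * cmod (f x)" and ?v = "\<lambda>x. \<bar>x\<bar> ^ Suc e * cmod (g x)"
  have uv: "?u summable_on L" "?v summable_on L"
    using assms by (auto simp: wsummable_def)
  have le: "\<bar>x\<bar> ^ Suc e * cmod (f x + g x) \<le> ?u x + ?v x" for x
    unfolding distrib_left[symmetric] by (intro mult_left_mono norm_triangle_ineq) auto
  show s: "wsummable e (\<lambda>x. f x + g x)"
    unfolding wsummable_def
    by (rule summable_on_comparison_test[OF summable_on_add[OF uv] le]) auto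
  show "wnorm e (\<lambda>x. f x + g x) \<le> wnorm e f + wnorm e g"
    unfolding wnorm_def infsum_add[OF uv, symmetric]
    by (rule infsum_mono[OF s[unfolded wsummable_def] summable_on_add[OF uv] le])
qed

lemma wnorm_cmult:
  shows "wsummable e f \<Longrightarrow> wsummable e (\<lambda>x. c * f x)"
    and "wnorm e (\<lambda>x. c * f x) = cmod c * wnorm e f"
proof -
  have eq: "(\<lambda>x. \<bar>x\<bar> ^ Suc e * cmod (c * f x)) = (\<lambda>x. cmod c * (\<bar>x\<bar> ^ Suc e * cmod (f x)))"
    by (simp add: norm_mult mult_ac)
  show "wsummable e f \<Longrightarrow> wsummable e (\<lambda>x. c * f x)"
    unfolding wsummable_def eq by (rule summable_on_cmult_right)
  show "wnorm e (\<lambda>x. c * f x) = cmod c * wnorm e f"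
    unfolding wnorm_def eq by (rule infsum_cmult_right')
qed

lemma subspace_I_s_omega: "cfun.subspace (I_s_omega q \<gamma>)"
  unfolding cfun.subspace_def
proof (intro conjI ballI allI)
  have "wsummable e (\<lambda>x. 0)" "wnorm e (\<lambda>x. 0) = 0" for e
    by (auto simp: wsummable_def wnorm_def)
  moreover have "gaussian_bounded q (\<lambda>e. 0)"
    unfolding gaussian_bounded_def using q_pos by (intro exI[of _ "1::real"] conjI) auto
  ultimately show "0 \<in> I_s_omega q \<gamma>"
    by (simp add: mem_I_s_omega_iff mem_I_infty_iff zero_fun_def qabs_moment_eq)
next
  fix f g assume f: "f \<in> I_s_omega q \<gamma>" and g: "g \<in> I_s_omega q \<gamma>"
  have "\<bar>qabs_moment q \<gamma> e (\<lambda>x. f x + g x)\<bar> \<le> qabs_moment q \<gamma> e f + qabs_moment q \<gamma> e g" for e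
  proof -
    have "wnorm e (\<lambda>x. f x + g x) \<le> wnorm e f + wnorm e g"
      using f g by (intro wnorm_add) (auto simp: mem_I_s_omega_iff mem_I_infty_iff)
    then show ?thesis
      using q_less_1 wnorm_nonneg
      by (simp add: qabs_moment_eq abs_mult mult_left_mono flip: distrib_left)
  qed
  with f g show "f + g \<in> I_s_omega q \<gamma>"
    by (auto simp: mem_I_s_omega_iff mem_I_infty_iff plus_fun_def wnorm_add(1)
        intro: gaussian_bounded_mono[OF gaussian_bounded_add[OF q_pos q_less_1]])
next
  fix c f assume f: "f \<in> I_s_omega q \<gamma>"
  have "qabs_moment q \<gamma> e (\<lambda>x. c * f x) = cmod c * qabs_moment q \<gamma> e f" for e
    by (simp add: qabs_moment_eq wnorm_cmult)
  with f show "(\<lambda>x. c * f x) \<in> I_s_omega q \<gamma>"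
    by (auto simp: mem_I_s_omega_iff mem_I_infty_iff wnorm_cmult(1) intro: gaussian_bounded_cmult)
qed

lemma subspace_HD:
  assumes I: "cfun.subspace I"
  shows "cfun.subspace (HD q \<gamma> I)"
  unfolding cfun.subspace_def
proof (intro conjI ballI allI)
  show "0 \<in> HD q \<gamma> I"
    using cfun.subspace_0[OF I] unfolding HD_def
    by (auto intro!: exI[of _ "1::real"] exI[of _ "\<lambda>_. 0::complex"])
next
  fix f g assume "f \<in> HD q \<gamma> I" and "g \<in> HD q \<gamma> I"
  then obtain r F s G where f: "f \<in> I" "r > 0" "F holomorphic_on ball 0 r"
      "\<forall>x\<in>L. \<bar>x\<bar> < r \<longrightarrow> f x = F (of_real x)"
    and g: "g \<in> I" "s > 0" "G holomorphic_on ball 0 s"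
      "\<forall>x\<in>L. \<bar>x\<bar> < s \<longrightarrow> g x = G (of_real x)"
    unfolding HD_def by blast
  have "(\<lambda>z. F z + G z) holomorphic_on ball 0 (min r s)"
    using f(3) g(3) by (intro holomorphic_intros) (auto elim: holomorphic_on_subset)
  moreover have "f + g \<in> I"
    using cfun.subspace_add[OF I] f g by blast
  moreover have "min r s > 0"
    using f(2) g(2) by simp
  ultimately show "f + g \<in> HD q \<gamma> I"
    unfolding HD_def using f(4) g(4) by fastforce
next
  fix c f assume "f \<in> HD q \<gamma> I"
  then obtain r F where f: "f \<in> I" "r > 0" "F holomorphic_on ball 0 r"
      "\<forall>x\<in>L. \<bar>x\<bar> < r \<longrightarrow> f x = F (of_real x)"
    unfolding HD_def by blast
  have "(\<lambda>z. c * F z) holomorphic_on ball 0 r"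
    using f(3) by (intro holomorphic_intros)
  moreover have "(\<lambda>x. c * f x) \<in> I"
    using cfun.subspace_scale[OF I] f by blast
  ultimately show "(\<lambda>x. c * f x) \<in> HD q \<gamma> I"
    unfolding HD_def using f(2,4) by fastforce
qed

lemma subspace_HS:
  assumes I: "cfun.subspace I"
  shows "cfun.subspace (HS q \<gamma> I)"
  unfolding cfun.subspace_def
proof (intro conjI ballI allI)
  show "0 \<in> HS q \<gamma> I"
    using cfun.subspace_0[OF I] unfolding HS_def
    by (auto intro!: exI[of _ "1::real"] exI[of _ "\<lambda>_. 0::complex"])
next
  fix f g assume "f \<in> HS q \<gamma> I" and "g \<in> HS q \<gamma> I"
  then obtain r F s G where f: "f \<in> I" "r > 0" "F holomorphic_on {z. \<bar>Im z\<bar> < r}"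
      "\<forall>x\<in>L. f x = F (of_real x)"
    and g: "g \<in> I" "s > 0" "G holomorphic_on {z. \<bar>Im z\<bar> < s}"
      "\<forall>x\<in>L. g x = G (of_real x)"
    unfolding HS_def by blast
  have "(\<lambda>z. F z + G z) holomorphic_on {z. \<bar>Im z\<bar> < min r s}"
    using f(3) g(3) by (intro holomorphic_intros) (auto elim: holomorphic_on_subset)
  moreover have "f + g \<in> I"
    using cfun.subspace_add[OF I] f g by blast
  moreover have "min r s > 0"
    using f(2) g(2) by simp
  ultimately show "f + g \<in> HS q \<gamma> I"
    unfolding HS_def using f(4) g(4) by fastforce
next
  fix c f assume "f \<in> HS q \<gamma> I"
  then obtain r F where f: "f \<in> I" "r > 0" "F holomorphic_on {z. \<bar>Im z\<bar> < r}"
      "\<forall>x\<in>L. f x = F (of_real x)"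
    unfolding HS_def by blast
  have "(\<lambda>z. c * F z) holomorphic_on {z. \<bar>Im z\<bar> < r}"
    using f(3) by (intro holomorphic_intros)
  moreover have "(\<lambda>x. c * f x) \<in> I"
    using cfun.subspace_scale[OF I] f by blast
  ultimately show "(\<lambda>x. c * f x) \<in> HS q \<gamma> I"
    unfolding HS_def using f(2,4) by fastforce
qed

section \<open>Convolution products\<close>

definition qconv_coeff :: "(real \<Rightarrow> complex) \<Rightarrow> nat \<Rightarrow> complex" where
  "qconv_coeff f e = (-1) ^ e * qmoment q \<gamma> e f / of_real (qfact q e)"

lemma gaussian_bounded_qconv_coeff:
  assumes "f \<in> I_omega q \<gamma>"
  shows "gaussian_bounded q (\<lambda>e. cmod (qconv_coeff f e))"
proof (rule gaussian_bounded_mono)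
  show "gaussian_bounded q (\<lambda>e. cmod (qmoment q \<gamma> e f))"
    using assms by (simp add: mem_I_omega_iff)
  show "\<bar>cmod (qconv_coeff f e)\<bar> \<le> cmod (qmoment q \<gamma> e f)" for e
    using qfact_ge_1[OF q_pos q_less_1, of e] divide_left_mono[of 1 "qfact q e" "cmod (qmoment q \<gamma> e f)"]
    by (simp add: qconv_coeff_def norm_mult norm_divide norm_power)
qed

text \<open>The factor \<open>w ^ e\<close> is absorbed into the base of the Gaussian bound, so the
  coefficients beat every geometric growth of the iterated q-derivatives.\<close>

lemma summable_qconv_coeff:
  assumes "f \<in> I_omega q \<gamma>" "0 < w"
  shows "summable (\<lambda>e. cmod (qconv_coeff f e) * w ^ e)"
proof -
  obtain \<alpha> b C where A: "0 < \<alpha>" "0 < b" "0 < C"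
    "\<And>n. \<bar>cmod (qconv_coeff f n)\<bar> \<le> C * (q powr (\<alpha> * real n ^ 2 / 2) * b ^ n)"
    using gaussian_bounded_qconv_coeff[OF assms(1)] unfolding gaussian_bounded_def by blast
  show ?thesis
  proof (rule summable_comparison_test')
    show "summable (\<lambda>n. C * (q powr (\<alpha> * real n ^ 2 / 2) * (b * w) ^ n))"
      using A assms q_pos q_less_1 by (intro summable_mult summable_gaussian) auto
    show "norm (cmod (qconv_coeff f n) * w ^ n) \<le> C * (q powr (\<alpha> * real n ^ 2 / 2) * (b * w) ^ n)" for n
      using mult_right_mono[OF A(4)[of n], of "w ^ n"] assms(2)
      by (simp add: abs_mult power_mult_distrib mult_ac)
  qed
qed

lemma qconv_term_eq: "qconv_term q \<gamma> f g x = (\<lambda>e. qconv_coeff f e * (qderiv q ^^ e) g x)"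
  by (simp add: fun_eq_iff qconv_term_def qconv_coeff_def)

lemma qconv_eq: "x \<in> L \<Longrightarrow> qconv q \<gamma> f g x = (\<Sum>e. qconv_coeff f e * (qderiv q ^^ e) g x)"
  by (simp add: qconv_def qconv_term_eq)

text \<open>Only the decay of the signed moments of \<open>f\<close> enters; absolute moments and
  holomorphy near 0 are asked of \<open>g\<close> alone. This asymmetry is the source of the left
  ideals.\<close>

lemma qconv_I_omega_HD_I_s_omega:
  assumes f: "f \<in> I_omega q \<gamma>" and g: "g \<in> HD q \<gamma> (I_s_omega q \<gamma>)"
  shows "qconv_defined q \<gamma> f g" and "qconv q \<gamma> f g \<in> I_s_omega q \<gamma>"
proof -
  obtain r F where g': "g \<in> I_s_omega q \<gamma>" "r > 0" "F holomorphic_on ball 0 r"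
      "\<And>x. x \<in> L \<Longrightarrow> \<bar>x\<bar> < r \<Longrightarrow> g x = F (of_real x)"
    using g unfolding HD_def by blast
  have ws: "wsummable e g" for e
    using g'(1) by (simp add: mem_I_s_omega_iff mem_I_infty_iff)
  obtain M w where M: "0 < M" "0 < w" "\<And>n x. x \<in> L \<Longrightarrow> cmod ((qderiv q ^^ n) g x) \<le> M * w ^ n"
    using qderiv_iterate_bounded[OF ws g'(3,2,4)] by blast
  have conv: "summable (\<lambda>n. cmod (qconv_coeff f n * (qderiv q ^^ n) g x))" if "x \<in> L" for x
  proof (rule summable_comparison_test')
    show "summable (\<lambda>n. M * (cmod (qconv_coeff f n) * w ^ n))"
      by (intro summable_mult summable_qconv_coeff f M)
    show "norm (cmod (qconv_coeff f n * (qderiv q ^^ n) g x)) \<le> M * (cmod (qconv_coeff f n) * w ^ n)" for n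
      using mult_left_mono[OF M(3)[OF that, of n], of "cmod (qconv_coeff f n)"]
      by (simp add: norm_mult mult_ac)
  qed
  then show "qconv_defined q \<gamma> f g"
    by (simp add: qconv_defined_def qconv_term_eq)
  have "gaussian_bounded q (\<lambda>e. qabs_moment q \<gamma> e g)"
    using g'(1) by (simp add: mem_I_s_omega_iff)
  note moments = gaussian_series_moments[where u = "qconv q \<gamma> f g", OF ws M this gaussian_bounded_qconv_coeff[OF f] qconv_eq conv]
  show "qconv q \<gamma> f g \<in> I_s_omega q \<gamma>"
    using moments by (simp add: mem_I_s_omega_iff mem_I_infty_iff) (simp add: qconv_def)
qed

text \<open>The extension is the same series with \<open>cqderiv\<close> in place of
  \<open>qderiv\<close>. Leaving \<open>U\<close> general treats the disk and the strip at once and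
  keeps the domain of \<open>g\<close>.\<close>

lemma qconv_holomorphic:
  assumes "f \<in> I_omega q \<gamma>" "F holomorphic_on U" "open U" "convex U" "0 \<in> U"
    and g: "\<And>x. x \<in> L \<Longrightarrow> of_real x \<in> U \<Longrightarrow> g x = F (of_real x)"
  obtains H where "H holomorphic_on U"
    "\<And>x. x \<in> L \<Longrightarrow> of_real x \<in> U \<Longrightarrow> qconv q \<gamma> f g x = H (of_real x)"
proof
  show "(\<lambda>z. \<Sum>n. qconv_coeff f n * (cqderiv q ^^ n) F z) holomorphic_on U"
    by (rule holomorphic_cqderiv_series[OF assms(2-5) q_pos q_less_1 summable_qconv_coeff[OF assms(1)]])
  fix x assume x: "x \<in> L" "of_real x \<in> U"
  have "(qderiv q ^^ n) g x = (cqderiv q ^^ n) F (of_real x)" for n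
  proof (rule qderiv_iterate_eq_cqderiv[where S = "{x \<in> L. of_real x \<in> U}"])
    show "q * y \<in> {x \<in> L. of_real x \<in> U}" if "y \<in> {x \<in> L. of_real x \<in> U}" for y
      using that lattice_scale convex_qscale[OF assms(4,5) q_pos q_less_1, of "of_real y"] by auto
  qed (use g x zero_notin_lattice in auto)
  then show "qconv q \<gamma> f g x = (\<Sum>n. qconv_coeff f n * (cqderiv q ^^ n) F (of_real x))"
    by (simp add: qconv_eq x)
qed

lemma qconv_HD:
  assumes f: "f \<in> I_omega q \<gamma>" and g: "g \<in> HD q \<gamma> (I_s_omega q \<gamma>)"
  shows "qconv q \<gamma> f g \<in> HD q \<gamma> (I_s_omega q \<gamma>)"
proof -
  obtain r F where F: "r > 0" "F holomorphic_on ball 0 r"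
      "\<And>x. x \<in> L \<Longrightarrow> \<bar>x\<bar> < r \<Longrightarrow> g x = F (of_real x)"
    using g unfolding HD_def by blast
  obtain H where "H holomorphic_on ball 0 r"
    "\<And>x. x \<in> L \<Longrightarrow> of_real x \<in> ball (0::complex) r \<Longrightarrow> qconv q \<gamma> f g x = H (of_real x)"
    using qconv_holomorphic[OF f F(2), of g] F by auto
  then show ?thesis
    using qconv_I_omega_HD_I_s_omega(2)[OF f g] F(1) unfolding HD_def by auto
qed

lemma qconv_HS:
  assumes f: "f \<in> I_omega q \<gamma>" and g: "g \<in> HS q \<gamma> (I_s_omega q \<gamma>)"
  shows "qconv q \<gamma> f g \<in> HS q \<gamma> (I_s_omega q \<gamma>)"
proof -
  obtain a F where F: "a > 0" "F holomorphic_on {z. \<bar>Im z\<bar> < a}"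
      "\<And>x. x \<in> L \<Longrightarrow> g x = F (of_real x)"
    using g unfolding HS_def by blast
  have strip: "{z. \<bar>Im z\<bar> < a} = {z. Im z < a} \<inter> {z. Im z > - a}"
    by auto
  have "convex {z. \<bar>Im z\<bar> < a}" "open {z. \<bar>Im z\<bar> < a}"
    unfolding strip
    by (intro convex_Int open_Int convex_halfspace_Im_lt convex_halfspace_Im_gt
        open_halfspace_Im_lt open_halfspace_Im_gt)+
  then obtain H where "H holomorphic_on {z. \<bar>Im z\<bar> < a}"
    "\<And>x. x \<in> L \<Longrightarrow> of_real x \<in> {z. \<bar>Im z\<bar> < a} \<Longrightarrow> qconv q \<gamma> f g x = H (of_real x)"
    using qconv_holomorphic[OF f F(2), of g] F by auto
  then show ?thesis
    using qconv_I_omega_HD_I_s_omega(2)[OF f subsetD[OF HS_subset_HD g]] F(1) unfolding HS_def by auto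
qed

end

theorem corollary5p9:
  fixes q \<gamma> :: real
  assumes "0 < q" and "q < 1" and "0 < \<gamma>"
  shows "qsubalgebra q \<gamma> (HD q \<gamma> (I_s_omega q \<gamma>)) (HD q \<gamma> (I_omega q \<gamma>)) \<and>
         qleft_ideal q \<gamma> (HS q \<gamma> (I_s_omega q \<gamma>)) (HS q \<gamma> (I_omega q \<gamma>)) \<and>
         qleft_ideal q \<gamma> (HS q \<gamma> (I_s_omega q \<gamma>)) (HD q \<gamma> (I_omega q \<gamma>)) \<and>
         qleft_ideal q \<gamma> (HS q \<gamma> (I_s_omega q \<gamma>)) (HD q \<gamma> (I_s_omega q \<gamma>))"
proof -
  interpret q_lattice q \<gamma>
    by unfold_locales (rule assms)+
  have HD_mono: "HD q \<gamma> I \<subseteq> HD q \<gamma> J" and HS_mono: "HS q \<gamma> I \<subseteq> HS q \<gamma> J" if "I \<subseteq> J" for I J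
    using that by (auto simp: HD_def HS_def)
  note incl = HD_mono[OF I_s_omega_subset_I_omega] HS_mono[OF I_s_omega_subset_I_omega]
    HS_subset_HD I_s_omega_subset_I_omega
  have base: "HD q \<gamma> I \<subseteq> I" "HS q \<gamma> I \<subseteq> I" for I
    by (auto simp: HD_def HS_def)
  \<comment> \<open>Left factors need only lie in \<open>I_omega q \<gamma>\<close>, so all three
    ideal statements reduce to inclusions of classes.\<close>
  have left_ideal: "qleft_ideal q \<gamma> (HS q \<gamma> (I_s_omega q \<gamma>)) A"
    if "HS q \<gamma> (I_s_omega q \<gamma>) \<subseteq> A" "A \<subseteq> I_omega q \<gamma>" for A
    unfolding qleft_ideal_def
    using that subspace_HS[OF subspace_I_s_omega] qconv_HS qconv_I_omega_HD_I_s_omega(1) HS_subset_HD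
    by (meson subset_iff)
  have "qsubalgebra q \<gamma> (HD q \<gamma> (I_s_omega q \<gamma>)) (HD q \<gamma> (I_omega q \<gamma>))"
    unfolding qsubalgebra_def
    using subspace_HD[OF subspace_I_s_omega] qconv_HD qconv_I_omega_HD_I_s_omega(1) incl base
    by (meson subset_iff)
  moreover have "qleft_ideal q \<gamma> (HS q \<gamma> (I_s_omega q \<gamma>)) (HS q \<gamma> (I_omega q \<gamma>))"
    by (rule left_ideal[OF incl(2) base(2)])
  moreover have "qleft_ideal q \<gamma> (HS q \<gamma> (I_s_omega q \<gamma>)) (HD q \<gamma> (I_omega q \<gamma>))"
    by (rule left_ideal[OF order_trans[OF incl(2,3)] base(1)])
  moreover have "qleft_ideal q \<gamma> (HS q \<gamma> (I_s_omega q \<gamma>)) (HD q \<gamma> (I_s_omega q \<gamma>))"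
    by (rule left_ideal[OF incl(3) order_trans[OF base(1) incl(4)]])
  ultimately show ?thesis
    by blast
qed

end
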